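(* Let $n \geq 2$ and let $H \in C^1(\mathbb{R}^n)$. Assume that there exists a straight line segment $[a,b] \subseteq \mathbb{R}^n$ along which $H$ is constant. Then, for any $f \in W^{1,\infty}_{loc}(\mathbb{R})$ satisfying $\|f'\|_{L^\infty(\mathbb{R})} < 1$, the formula $$u(x) := \frac{b+a}{2}\cdot x + f\left(\frac{b-a}{2}\cdot x\right), \quad x \in \mathbb{R}^n,$$ defines a function $u \in W^{1,\infty}_{loc}(\mathbb{R}^n)$ which is an (entire) viscosity solution on $\mathbb{R}^n$ of the Aronsson equation $$D^2u : H_p(Du)\otimes H_p(Du) = 0.$$
   Context: For $a,b\in\mathbb{R}^n$, $[a,b]=\{\lambda a+(1-\lambda)b : \lambda\in[0,1]\}$. The vector $H_p = (H_{p_1},\dots,H_{p_n})$ is the gradient of $H$. The Aronsson operator is $\mathcal{A}[u] := D^2u : H_p(Du)\otimes H_p(Du) = \sum_{i,j=1}^n D^2_{ij}u\, H_{p_i}(Du)\, H_{p_j}(Du)$, for $u\in C^2(\mathbb{R}^n)$. Functions in $W^{1,\infty}_{loc}$ are identified with their continuous (locally Lipschitz) representatives. Viscosity solutions are in the sense of Crandall-Ishii-Lions: a continuous function $u:\mathbb{R}^n\to\mathbb{R}$ is a viscosity solution of $\mathcal{A}[u]=0$ on $\mathbb{R}^n$ if, for every $x_0\in\mathbb{R}^n$ and every $\varphi$ of class $C^2$ near $x_0$: whenever $u-\varphi$ has a local maximum at $x_0$, $\mathcal{A}[\varphi](x_0)\geq 0$; and whenever $u-\varphi$ has a local minimum at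 $x_0$, $\mathcal{A}[\varphi](x_0)\leq 0$. *)

theory Defs
  imports "HOL-Analysis.Analysis" "HOL-Probability.Essential_Supremum"
begin

definition partial_deriv :: "'a::euclidean_space \<Rightarrow> ('a \<Rightarrow> real) \<Rightarrow> 'a \<Rightarrow> real" where
  "partial_deriv i \<phi> x = frechet_derivative \<phi> (at x) i"

definition gradient :: "('a::euclidean_space \<Rightarrow> real) \<Rightarrow> 'a \<Rightarrow> 'a" where
  "gradient \<phi> x = (\<Sum>i\<in>Basis. partial_deriv i \<phi> x *\<^sub>R i)"

(* Class C^k on a set S; only meant for open S, where the two-sided derivatives
   used here depend only on the values of \<phi> on S. *)
primrec Ck_on :: "nat \<Rightarrow> 'a::euclidean_space set \<Rightarrow> ('a \<Rightarrow> real) \<Rightarrow> bool" where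
  "Ck_on 0 S \<phi> \<longleftrightarrow> continuous_on S \<phi>"
| "Ck_on (Suc k) S \<phi> \<longleftrightarrow>
     (\<forall>x\<in>S. \<phi> differentiable at x) \<and> (\<forall>i\<in>Basis. Ck_on k S (partial_deriv i \<phi>))"

definition test_function :: "('a::euclidean_space \<Rightarrow> real) \<Rightarrow> bool" where
  "test_function \<phi> \<longleftrightarrow>
     (\<forall>k. Ck_on k UNIV \<phi>) \<and> (\<exists>K. compact K \<and> (\<forall>x. x \<notin> K \<longrightarrow> \<phi> x = 0))"

definition locally_integrable :: "('a::euclidean_space \<Rightarrow> real) \<Rightarrow> bool" where
  "locally_integrable g \<longleftrightarrow> (\<forall>K. compact K \<longrightarrow> set_integrable lebesgue K g)"

definition has_weak_partial ::
    "('a::euclidean_space \<Rightarrow> real) \<Rightarrow> 'a \<Rightarrow> ('a \<Rightarrow> real) \<Rightarrow> bool" where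
  "has_weak_partial u i g \<longleftrightarrow> locally_integrable u \<and> locally_integrable g \<and>
     (\<forall>\<phi>. test_function \<phi> \<longrightarrow>
        (LINT x|lebesgue. u x * partial_deriv i \<phi> x) = - (LINT x|lebesgue. g x * \<phi> x))"

definition Linf_norm :: "('a::euclidean_space \<Rightarrow> real) \<Rightarrow> ereal" where
  "Linf_norm g = esssup lebesgue (\<lambda>x. ereal \<bar>g x\<bar>)"

definition Linf_loc :: "('a::euclidean_space \<Rightarrow> real) \<Rightarrow> bool" where
  "Linf_loc g \<longleftrightarrow> g \<in> borel_measurable lebesgue \<and>
     (\<forall>K. compact K \<longrightarrow> Linf_norm (\<lambda>x. indicator K x * g x) < \<infinity>)"

(* The choice of the continuous representative is not part of this predicate. *)
definition W1inf_loc :: "('a::euclidean_space \<Rightarrow> real) \<Rightarrow> bool" where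
  "W1inf_loc u \<longleftrightarrow> Linf_loc u \<and> (\<forall>i\<in>Basis. \<exists>g. Linf_loc g \<and> has_weak_partial u i g)"

definition aronsson ::
    "('a::euclidean_space \<Rightarrow> real) \<Rightarrow> ('a \<Rightarrow> real) \<Rightarrow> 'a \<Rightarrow> real" where
  "aronsson H \<phi> x =
     (\<Sum>i\<in>Basis. \<Sum>j\<in>Basis. partial_deriv i (partial_deriv j \<phi>) x
        * partial_deriv i H (gradient \<phi> x) * partial_deriv j H (gradient \<phi> x))"

definition C2_near :: "'a::euclidean_space \<Rightarrow> ('a \<Rightarrow> real) \<Rightarrow> bool" where
  "C2_near x0 \<phi> \<longleftrightarrow> (\<exists>S. open S \<and> x0 \<in> S \<and> Ck_on 2 S \<phi>)"

definition local_max_at :: "('a::topological_space \<Rightarrow> real) \<Rightarrow> 'a \<Rightarrow> bool" where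
  "local_max_at w x0 \<longleftrightarrow> (\<forall>\<^sub>F x in nhds x0. w x \<le> w x0)"

definition local_min_at :: "('a::topological_space \<Rightarrow> real) \<Rightarrow> 'a \<Rightarrow> bool" where
  "local_min_at w x0 \<longleftrightarrow> (\<forall>\<^sub>F x in nhds x0. w x0 \<le> w x)"

definition aronsson_viscosity_solution ::
    "('a::euclidean_space \<Rightarrow> real) \<Rightarrow> ('a \<Rightarrow> real) \<Rightarrow> bool" where
  "aronsson_viscosity_solution H u \<longleftrightarrow> continuous_on UNIV u \<and>
     (\<forall>x0 \<phi>. C2_near x0 \<phi> \<longrightarrow>
        (local_max_at (\<lambda>x. u x - \<phi> x) x0 \<longrightarrow> aronsson H \<phi> x0 \<ge> 0) \<and>
        (local_min_at (\<lambda>x. u x - \<phi> x) x0 \<longrightarrow> aronsson H \<phi> x0 \<le> 0))"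

end

theory Submission
  imports Defs
begin

text \<open>
  Put \<open>c = (b + a) / 2\<close> and \<open>d = (b - a) / 2\<close>, so that \<open>u x = c \<bullet> x + f (d \<bullet> x)\<close> and the
  segment consists of the points \<open>c + t d\<close> with \<open>\<bar>t\<bar> \<le> 1\<close>.

  The viscosity property has a geometric reason. The function \<open>f\<close> is Lipschitz with a constant
  \<open>L < 1\<close>, so a test function \<open>\<phi>\<close> touching \<open>u\<close> at \<open>x0\<close> from either side has gradient
  \<open>p = c + t d\<close> with \<open>\<bar>t\<bar> \<le> L\<close> (\<open>gradient_at_touching_point\<close>). Hence \<open>p\<close> is a point of the
  segment with room on both sides, and since \<open>H\<close> is constant there, \<open>q = H\<^sub>p(p)\<close> is orthogonal
  to \<open>d\<close> (\<open>gradient_orthogonal_to_constancy_segment\<close>). Along the line \<open>x0 + s q\<close> the function \<open>u\<close> is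
  therefore affine, however rough \<open>f\<close> may be, and \<open>\<phi>\<close> minus an affine function has a
  local extremum at \<open>s = 0\<close>. The Aronsson operator is exactly the second derivative of \<open>\<phi>\<close> along
  this line, so it has the required sign
  (\<open>aronsson_viscosity_solution_constancy_segment\<close>).

  The rest is about the weak derivative \<open>f'\<close>. Testing with smooth plateaus that converge to the
  indicator of \<open>[s, t]\<close> gives \<open>f t - f s\<close> as the integral of \<open>f'\<close> over \<open>[s, t]\<close>
  (\<open>weak_derivative_integral\<close>); replacing \<open>f'\<close> by a truncated Borel version \<open>g\<close> turns the
  essential bound into a bound everywhere (\<open>bounded_borel_derivative\<close>), which yields the Lipschitz
  constant. Then \<open>u\<close> is, on every line parallel to a coordinate axis, the integral of the bounded
  Borel function \<open>c\<^sub>i + d\<^sub>i g (d \<bullet> x)\<close>, and a difference quotient argument with Fubini's theorem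
  shows that this function is a weak partial derivative (\<open>has_weak_partial_of_line_integrals\<close>).
\<close>

section \<open>Smooth functions on the real line\<close>

lemma partial_deriv_real_eqI:
  fixes \<phi> :: "real \<Rightarrow> real"
  assumes "(\<phi> has_real_derivative D) (at x)"
  shows "partial_deriv 1 \<phi> x = D"
proof -
  have "frechet_derivative \<phi> (at x) = (*) D"
    using assms by (metis frechet_derivative_at has_field_derivative_def)
  then show ?thesis by (simp add: partial_deriv_def)
qed

lemma Ck_on_Suc_realI:
  fixes \<phi> \<phi>' :: "real \<Rightarrow> real"
  assumes "\<And>x. (\<phi> has_real_derivative \<phi>' x) (at x)" and "Ck_on k UNIV \<phi>'"
  shows "Ck_on (Suc k) UNIV \<phi>"
proof -
  have "partial_deriv 1 \<phi> = \<phi>'"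
    using assms(1) partial_deriv_real_eqI by blast
  with assms show ?thesis
    using real_differentiable_def by auto
qed

lemma Ck_on_Suc_realD:
  fixes \<phi> :: "real \<Rightarrow> real"
  assumes "Ck_on (Suc k) UNIV \<phi>"
  shows "(\<phi> has_real_derivative partial_deriv 1 \<phi> x) (at x)"
    and "Ck_on k UNIV (partial_deriv 1 \<phi>)"
proof -
  from assms obtain D where "(\<phi> has_real_derivative D) (at x)"
    unfolding Ck_on.simps real_differentiable_def by blast
  with partial_deriv_real_eqI[OF this]
  show "(\<phi> has_real_derivative partial_deriv 1 \<phi> x) (at x)" by simp
  show "Ck_on k UNIV (partial_deriv 1 \<phi>)" using assms by simp
qed

lemma Ck_on_Suc_imp_continuous_on:
  assumes "Ck_on (Suc k) S \<phi>"
  shows "continuous_on S \<phi>"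
  using assms by (auto intro!: continuous_at_imp_continuous_on differentiable_imp_continuous_within)

lemma Ck_on_SucD: "Ck_on (Suc k) S \<phi> \<Longrightarrow> Ck_on k S \<phi>"
proof (induction k arbitrary: \<phi>)
  case 0
  then show ?case using Ck_on_Suc_imp_continuous_on[of 0] by (simp only: Ck_on.simps(1))
qed auto

lemma Ck_on_const_real: "Ck_on k UNIV (\<lambda>x::real. c::real)"
proof (induction k arbitrary: c)
  case (Suc k)
  show ?case by (rule Ck_on_Suc_realI[OF _ Suc[of 0]]) auto
qed auto

lemma Ck_on_add_real:
  fixes \<phi> \<psi> :: "real \<Rightarrow> real"
  assumes "Ck_on k UNIV \<phi>" "Ck_on k UNIV \<psi>"
  shows "Ck_on k UNIV (\<lambda>x. \<phi> x + \<psi> x)"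
  using assms
proof (induction k arbitrary: \<phi> \<psi>)
  case (Suc k)
  show ?case
    using DERIV_add[OF Ck_on_Suc_realD(1)[OF Suc.prems(1)] Ck_on_Suc_realD(1)[OF Suc.prems(2)]]
      Suc.IH[OF Ck_on_Suc_realD(2)[OF Suc.prems(1)] Ck_on_Suc_realD(2)[OF Suc.prems(2)]]
    by (rule Ck_on_Suc_realI)
qed (auto intro: continuous_intros)

lemma Ck_on_mult_real:
  fixes \<phi> \<psi> :: "real \<Rightarrow> real"
  assumes "Ck_on k UNIV \<phi>" "Ck_on k UNIV \<psi>"
  shows "Ck_on k UNIV (\<lambda>x. \<phi> x * \<psi> x)"
  using assms
proof (induction k arbitrary: \<phi> \<psi>)
  case (Suc k)
  have "Ck_on k UNIV (\<lambda>x. partial_deriv 1 \<phi> x * \<psi> x + partial_deriv 1 \<psi> x * \<phi> x)"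
    by (rule Ck_on_add_real[OF Suc.IH[OF Ck_on_Suc_realD(2)[OF Suc.prems(1)] Ck_on_SucD[OF Suc.prems(2)]]
          Suc.IH[OF Ck_on_Suc_realD(2)[OF Suc.prems(2)] Ck_on_SucD[OF Suc.prems(1)]]])
  with DERIV_mult[OF Ck_on_Suc_realD(1)[OF Suc.prems(1)] Ck_on_Suc_realD(1)[OF Suc.prems(2)]]
  show ?case by (rule Ck_on_Suc_realI)
qed (auto intro: continuous_intros)

lemma Ck_on_affine_real:
  fixes \<phi> :: "real \<Rightarrow> real"
  assumes "Ck_on k UNIV \<phi>"
  shows "Ck_on k UNIV (\<lambda>x. \<phi> (r + s * x))"
  using assms
proof (induction k arbitrary: \<phi>)
  case 0
  then have "continuous_on UNIV \<phi>" by simp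
  then show ?case by (auto intro!: continuous_on_compose2[of UNIV \<phi>] continuous_intros)
next
  case (Suc k)
  have "((\<lambda>x. \<phi> (r + s * x)) has_real_derivative partial_deriv 1 \<phi> (r + s * x) * s) (at x)" for x
  proof -
    have "((\<lambda>x. r + s * x) has_real_derivative s) (at x)"
      by (auto intro!: derivative_eq_intros)
    with Ck_on_Suc_realD(1)[OF Suc.prems, of "r + s * x"] show ?thesis by (rule DERIV_chain2)
  qed
  moreover have "Ck_on k UNIV (\<lambda>x. partial_deriv 1 \<phi> (r + s * x) * s)"
    by (rule Ck_on_mult_real[OF Suc.IH[OF Ck_on_Suc_realD(2)[OF Suc.prems]] Ck_on_const_real])
  ultimately show ?case by (rule Ck_on_Suc_realI)
qed

text \<open>
  The derivative of \<open>1/\<phi>\<close> is \<open>-\<phi>' (1/\<phi>) (1/\<phi>)\<close>, so the case of order \<open>k + 1\<close> reduces to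
  products of functions known to be of class \<open>C\<^sup>k\<close>.
\<close>
lemma Ck_on_inverse_real:
  fixes \<phi> :: "real \<Rightarrow> real"
  assumes "Ck_on k UNIV \<phi>" and nz: "\<And>x. \<phi> x \<noteq> 0"
  shows "Ck_on k UNIV (\<lambda>x. inverse (\<phi> x))"
  using assms(1)
proof (induction k)
  case (Suc k)
  note IH = Suc.IH[OF Ck_on_SucD[OF Suc.prems]]
  have "((\<lambda>x. inverse (\<phi> x)) has_real_derivative
      (-1) * partial_deriv 1 \<phi> x * (inverse (\<phi> x) * inverse (\<phi> x))) (at x)" for x
    using DERIV_inverse_fun[OF Ck_on_Suc_realD(1)[OF Suc.prems, of x] nz]
    by (simp add: mult_ac)
  moreover have "Ck_on k UNIV (\<lambda>x. (-1) * partial_deriv 1 \<phi> x * (inverse (\<phi> x) * inverse (\<phi> x)))"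
    by (rule Ck_on_mult_real[OF Ck_on_mult_real[OF Ck_on_const_real Ck_on_Suc_realD(2)[OF Suc.prems]]
          Ck_on_mult_real[OF IH IH]])
  ultimately show ?case by (rule Ck_on_Suc_realI)
qed (use nz in \<open>auto intro: continuous_intros\<close>)

text \<open>
  These are the functions \<open>x\<^sup>-\<^sup>m exp (-1/x)\<close>, extended by zero. The derivative of
  one is a linear combination of two others, so that an induction over the order of
  differentiation proves all of them smooth at once.
\<close>
definition flat_exp :: "nat \<Rightarrow> real \<Rightarrow> real" where
  "flat_exp m x = (if x \<le> 0 then 0 else inverse x ^ m * exp (- inverse x))"

text \<open>
  Exponential decay beats the pole of any order. This limit for the exponent \<open>m + 1\<close> is that of
  the difference quotients at 0 for the exponent \<open>m\<close>.
\<close>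
lemma flat_exp_tendsto_0: "(flat_exp m \<longlongrightarrow> 0) (at 0)"
proof -
  have "((\<lambda>x. inverse x ^ m / exp (inverse x)) \<longlongrightarrow> (0::real)) (at_right 0)"
    by (rule filterlim_compose[OF tendsto_power_div_exp_0 filterlim_inverse_at_top_right])
  then have "(flat_exp m \<longlongrightarrow> 0) (at_right 0)"
    by (rule Lim_transform_eventually)
      (auto simp: eventually_at_filter flat_exp_def exp_minus divide_inverse)
  moreover have "(flat_exp m \<longlongrightarrow> 0) (at_left 0)"
    by (rule Lim_transform_eventually[OF tendsto_const])
      (auto simp: eventually_at_filter flat_exp_def)
  ultimately show ?thesis by (intro filterlim_split_at)
qed

lemma flat_exp_has_derivative:
  "(flat_exp m has_real_derivative flat_exp (m + 2) x + - real m * flat_exp (m + 1) x) (at x)"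
proof -
  consider "x < 0" | "x = 0" | "x > 0" by linarith
  then show ?thesis
  proof cases
    case 1
    have "(flat_exp m has_real_derivative 0) (at x)"
      by (rule has_field_derivative_transform_within_open[OF DERIV_const, of "{..<0}"])
        (use 1 in \<open>auto simp: flat_exp_def\<close>)
    with 1 show ?thesis by (simp add: flat_exp_def)
  next
    case 2
    \<comment> \<open>The difference quotient of \<open>flat_exp m\<close> at 0 is \<open>flat_exp (Suc m)\<close>.\<close>
    have "((\<lambda>h. (flat_exp m (0 + h) - flat_exp m 0) / h) \<longlongrightarrow> 0) (at 0)"
      by (rule Lim_transform_eventually[OF flat_exp_tendsto_0[of "Suc m"]])
        (auto simp: eventually_at_filter flat_exp_def field_simps)
    with 2 show ?thesis by (simp add: DERIV_def flat_exp_def)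
  next
    case 3
    have "((\<lambda>x. inverse x ^ m * exp (- inverse x)) has_real_derivative
        flat_exp (m + 2) x + - real m * flat_exp (m + 1) x) (at x)"
      using 3
      by (cases m; auto intro!: derivative_eq_intros simp: flat_exp_def power2_eq_square)
        (auto simp: field_simps power_eq_if)
    then show ?thesis
      by (rule has_field_derivative_transform_within_open[of _ _ _ "{0<..}"])
        (use 3 in \<open>auto simp: flat_exp_def\<close>)
  qed
qed

lemma Ck_on_flat_exp: "Ck_on k UNIV (flat_exp m)"
proof (induction k arbitrary: m)
  case 0
  then show ?case
    using flat_exp_has_derivative by (auto intro!: DERIV_isCont continuous_at_imp_continuous_on)
next
  case (Suc k)
  show ?case
    by (rule Ck_on_Suc_realI[OF flat_exp_has_derivative])
      (rule Ck_on_add_real[OF Suc Ck_on_mult_real[OF Ck_on_const_real Suc]])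
qed

text \<open>
  At every point \<open>x\<close> or \<open>1 - x\<close> is positive, so the denominator never vanishes. The term
  \<open>1 + (-1) * x\<close> has the shape \<open>r + s * x\<close> of \<open>Ck_on_affine_real\<close>.
\<close>
definition smooth_step :: "real \<Rightarrow> real" where
  "smooth_step x = flat_exp 0 x * inverse (flat_exp 0 x + flat_exp 0 (1 + (-1) * x))"

lemma Ck_on_smooth_step: "Ck_on k UNIV smooth_step"
proof -
  have "flat_exp 0 x + flat_exp 0 (1 + (-1) * x) \<noteq> 0" for x
    by (auto simp: flat_exp_def add_pos_pos less_imp_neq[symmetric])
  then have "Ck_on k UNIV (\<lambda>x. flat_exp 0 x * inverse (flat_exp 0 x + flat_exp 0 (1 + (-1) * x)))"
    by (rule Ck_on_mult_real[OF Ck_on_flat_exp Ck_on_inverse_real[OF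
          Ck_on_add_real[OF Ck_on_flat_exp Ck_on_affine_real[OF Ck_on_flat_exp]]]])
  then show ?thesis by (simp add: smooth_step_def[abs_def])
qed

lemma smooth_step_left: "x \<le> 0 \<Longrightarrow> smooth_step x = 0"
  and smooth_step_right: "1 \<le> x \<Longrightarrow> smooth_step x = 1"
  by (auto simp: smooth_step_def flat_exp_def)

lemma smooth_step_bounds: "0 \<le> smooth_step x" "smooth_step x \<le> 1"
proof -
  have "0 \<le> p * inverse (p + q) \<and> p * inverse (p + q) \<le> 1" if "0 \<le> p" "0 \<le> q" for p q :: real
    using that by (cases "p + q = 0") (auto simp: field_simps)
  from this[of "flat_exp 0 x" "flat_exp 0 (1 + (-1) * x)"]
  show "0 \<le> smooth_step x" "smooth_step x \<le> 1"
    unfolding smooth_step_def by (auto simp: flat_exp_def)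
qed

section \<open>Increments as integrals of the weak derivative\<close>

lemma integrable_lborel_compact_support:
  fixes h :: "'a::euclidean_space \<Rightarrow> real"
  assumes "h \<in> borel_measurable borel" "compact K"
    and "\<And>x. x \<in> K \<Longrightarrow> \<bar>h x\<bar> \<le> B" "\<And>x. x \<notin> K \<Longrightarrow> h x = 0"
  shows "integrable lborel h"
  by (rule integrableI_bounded_set[of K _ _ B])
    (use assms emeasure_compact_finite[of K] in \<open>auto simp: borel_compact\<close>)

lemma continuous_on_bounded_on_compact:
  fixes h :: "'a::topological_space \<Rightarrow> real"
  assumes "continuous_on UNIV h" "compact K"
  obtains M where "\<And>x. x \<in> K \<Longrightarrow> \<bar>h x\<bar> \<le> M"
proof -
  have "compact (h ` K)"
    using assms continuous_on_subset by (intro compact_continuous_image) auto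
  then have "bounded (h ` K)" by (rule compact_imp_bounded)
  then show thesis by (auto simp: bounded_iff intro: that)
qed

lemma integrable_continuous_compact_support:
  fixes h :: "'a::euclidean_space \<Rightarrow> real"
  assumes "continuous_on UNIV h" "compact K" "\<And>x. x \<notin> K \<Longrightarrow> h x = 0"
  shows "integrable lborel h"
proof -
  obtain B where "\<And>x. x \<in> K \<Longrightarrow> \<bar>h x\<bar> \<le> B"
    using continuous_on_bounded_on_compact[OF assms(1,2)] by blast
  then show ?thesis
    using assms by (intro integrable_lborel_compact_support[of h K B] borel_measurable_continuous_onI)
qed

definition step_deriv :: "real \<Rightarrow> real" where
  "step_deriv = partial_deriv 1 smooth_step"

lemma smooth_step_has_derivative: "(smooth_step has_real_derivative step_deriv x) (at x)"
  unfolding step_deriv_def by (rule Ck_on_Suc_realD(1)[OF Ck_on_smooth_step])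

lemma continuous_on_step_deriv: "continuous_on UNIV step_deriv"
  using Ck_on_Suc_realD(2)[OF Ck_on_smooth_step[of "Suc 0"]] by (simp add: step_deriv_def)

lemma step_deriv_eq_0: "x \<notin> {0..1} \<Longrightarrow> step_deriv x = 0"
proof -
  assume "x \<notin> {0..1}"
  then consider "x < 0" | "1 < x" by fastforce
  then have "(smooth_step has_real_derivative 0) (at x)"
  proof cases
    case 1
    show ?thesis
      by (rule has_field_derivative_transform_within_open[OF DERIV_const, of "{..<0}"])
        (use 1 in \<open>auto simp: smooth_step_left\<close>)
  next
    case 2
    show ?thesis
      by (rule has_field_derivative_transform_within_open[OF DERIV_const, of "{1<..}"])
        (use 2 in \<open>auto simp: smooth_step_right\<close>)
  qed
  then show ?thesis using smooth_step_has_derivative DERIV_unique by blast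
qed

lemma step_deriv_integral: "(LINT x|lborel. step_deriv x) = 1"
proof -
  have "(LINT x|lborel. step_deriv x) = (LINT x|lborel. step_deriv x * indicator {0..1} x)"
    by (intro Bochner_Integration.integral_cong) (auto simp: step_deriv_eq_0 split: split_indicator)
  also have "\<dots> = smooth_step 1 - smooth_step 0"
    by (rule integral_FTC_Icc_real)
      (use continuous_on_step_deriv in \<open>auto simp: smooth_step_has_derivative continuous_on_eq_continuous_at\<close>)
  also have "\<dots> = 1" by (simp add: smooth_step_left smooth_step_right)
  finally show ?thesis .
qed

text \<open>
  The derivative of the step is a bump of mass one on \<open>[0, 1]\<close>, so its rescalings form an
  approximate identity, concentrating to the right of \<open>s\<close>.
\<close>
lemma step_deriv_concentrates:
  fixes f :: "real \<Rightarrow> real"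
  assumes f: "continuous_on UNIV f"
  shows "(\<lambda>n. LINT x|lborel. f x * (real (Suc n) * step_deriv (real (Suc n) * (x - s)))) \<longlonglongrightarrow> f s"
proof -
  have "(LINT x|lborel. f x * (real (Suc n) * step_deriv (real (Suc n) * (x - s))))
      = (LINT y|lborel. f (s + inverse (real (Suc n)) * y) * step_deriv y)" for n
  proof -
    let ?N = "real (Suc n)"
    have "(LINT x|lborel. f x * (?N * step_deriv (?N * (x - s))))
      = \<bar>inverse ?N\<bar> *\<^sub>R (LINT y|lborel. f (s + inverse ?N * y) *
          (?N * step_deriv (?N * ((s + inverse ?N * y) - s))))"
      by (rule lborel_integral_real_affine) simp
    also have "\<dots> = inverse ?N * (LINT y|lborel. ?N * (f (s + inverse ?N * y) * step_deriv y))"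
      by (simp add: mult_ac del: of_nat_Suc)
    also have "\<dots> = (LINT y|lborel. f (s + inverse ?N * y) * step_deriv y)"
      by (simp del: of_nat_Suc)
    finally show ?thesis .
  qed
  moreover have "(\<lambda>n. LINT y|lborel. f (s + inverse (real (Suc n)) * y) * step_deriv y)
      \<longlonglongrightarrow> (LINT y|lborel. f s * step_deriv y)"
  proof -
    obtain M where M: "\<And>x. x \<in> {s..s+1} \<Longrightarrow> \<bar>f x\<bar> \<le> M"
      using continuous_on_bounded_on_compact[OF f compact_Icc] by blast
    have [measurable]: "f \<in> borel_measurable borel" "step_deriv \<in> borel_measurable borel"
      using f continuous_on_step_deriv by (auto intro: borel_measurable_continuous_onI)
    show ?thesis
    proof (rule integral_dominated_convergence[where w = "\<lambda>y. M * \<bar>step_deriv y\<bar>"])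
      show "integrable lborel (\<lambda>y. M * \<bar>step_deriv y\<bar>)"
        by (intro integrable_mult_right integrable_abs
            integrable_continuous_compact_support[OF continuous_on_step_deriv compact_Icc step_deriv_eq_0])
      have "f (s + inverse (real (Suc n)) * y) * step_deriv y \<le> M * \<bar>step_deriv y\<bar> \<and>
        - (f (s + inverse (real (Suc n)) * y) * step_deriv y) \<le> M * \<bar>step_deriv y\<bar>" for n y
      proof (cases "y \<in> {0..1}")
        case True
        then have "inverse (real (Suc n)) * y \<le> 1 * 1"
          by (intro mult_mono) (auto simp: field_simps)
        then have "\<bar>f (s + inverse (real (Suc n)) * y)\<bar> \<le> M"
          using True by (intro M) auto
        then have "\<bar>f (s + inverse (real (Suc n)) * y) * step_deriv y\<bar> \<le> M * \<bar>step_deriv y\<bar>"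
          by (simp add: abs_mult mult_right_mono)
        then show ?thesis by linarith
      qed (simp add: step_deriv_eq_0)
      then show "AE y in lborel. norm (f (s + inverse (real (Suc n)) * y) * step_deriv y)
          \<le> M * \<bar>step_deriv y\<bar>" for n
        by (intro AE_I2) (simp add: abs_le_iff)
      have "(\<lambda>n. s + inverse (real (Suc n)) * y) \<longlonglongrightarrow> s + 0 * y" for y
        by (intro tendsto_intros LIMSEQ_inverse_real_of_nat)
      then have "(\<lambda>n. f (s + inverse (real (Suc n)) * y)) \<longlonglongrightarrow> f (s + 0 * y)" for y
        using f by (intro isCont_tendsto_compose[of _ f]) (auto simp: continuous_on_eq_continuous_at)
      then show "AE y in lborel. (\<lambda>n. f (s + inverse (real (Suc n)) * y) * step_deriv y)
          \<longlonglongrightarrow> f s * step_deriv y"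
        by (auto intro!: tendsto_mult)
    qed simp_all
  qed
  ultimately show ?thesis by (simp add: step_deriv_integral)
qed

text \<open>
  The test function \<open>\<phi> n\<close> climbs from 0 to 1 immediately to the right of \<open>s\<close> and descends
  immediately to the right of \<open>t\<close>. As \<open>n\<close> grows it converges to the indicator of the interval
  (except at \<open>s\<close>), while its derivative converges to the difference of the point masses at
  \<open>s\<close> and \<open>t\<close>. The defining identity of the weak derivative becomes the
  fundamental theorem of calculus in the limit.
\<close>
lemma weak_derivative_integral:
  fixes f f' :: "real \<Rightarrow> real"
  assumes f: "continuous_on UNIV f" and weak: "has_weak_partial f 1 f'" and "s < t"
  shows "f t - f s = (LINT x|lebesgue. indicator {s..t} x * f' x)"
proof -
  define \<phi> where "\<phi> = (\<lambda>n x. smooth_step (real (Suc n) * (x - s)) - smooth_step (real (Suc n) * (x - t)))"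
  define D where "D = (\<lambda>r n x. real (Suc n) * step_deriv (real (Suc n) * (x - r)))"
  have \<phi>_0: "\<phi> n x = 0" if "x \<notin> {s..t+1}" for n x
  proof (cases "x < s")
    case True
    then show ?thesis using \<open>s < t\<close>
      by (simp add: \<phi>_def smooth_step_left mult_nonneg_nonpos del: of_nat_Suc)
  next
    case False
    with that have "t + 1 < x" by auto
    then have "1 * 1 \<le> real (Suc n) * (x - t)" "1 * 1 \<le> real (Suc n) * (x - s)"
      using \<open>s < t\<close> by (intro mult_mono; simp)+
    then show ?thesis by (simp add: \<phi>_def smooth_step_right del: of_nat_Suc)
  qed
  have test: "test_function (\<phi> n)" for n
    unfolding test_function_def
  proof (intro conjI allI exI)
    fix k
    let ?N = "real (Suc n)"
    have "Ck_on k UNIV (\<lambda>x. smooth_step (- ?N * s + ?N * x) + (-1) * smooth_step (- ?N * t + ?N * x))"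
      by (rule Ck_on_add_real[OF Ck_on_affine_real[OF Ck_on_smooth_step]
            Ck_on_mult_real[OF Ck_on_const_real Ck_on_affine_real[OF Ck_on_smooth_step]]])
    also have "(\<lambda>x. smooth_step (- ?N * s + ?N * x) + (-1) * smooth_step (- ?N * t + ?N * x)) = \<phi> n"
      by (simp add: \<phi>_def fun_eq_iff right_diff_distrib del: of_nat_Suc)
    finally show "Ck_on k UNIV (\<phi> n)" .
    show "compact {s..t+1}" by simp
    show "x \<notin> {s..t+1} \<longrightarrow> \<phi> n x = 0" for x using \<phi>_0 by blast
  qed
  have deriv: "partial_deriv 1 (\<phi> n) x = D s n x - D t n x" for n x
    unfolding \<phi>_def D_def
    by (rule partial_deriv_real_eqI)
      (auto intro!: derivative_eq_intros DERIV_chain'[OF _ smooth_step_has_derivative] simp del: of_nat_Suc)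
  have D_cont: "continuous_on UNIV (\<lambda>x. f x * D r n x)" for r n
    unfolding D_def
    by (intro continuous_on_mult f continuous_on_const
        continuous_on_compose2[OF continuous_on_step_deriv, of _ "\<lambda>x. real (Suc n) * (x - r)"]
        continuous_on_diff continuous_on_id subset_UNIV)
  \<comment> \<open>The integral of the difference can only be split because each bump is integrable by itself.\<close>
  have D_int: "integrable lborel (\<lambda>x. f x * D r n x)" for r n
  proof (rule integrable_continuous_compact_support[OF D_cont])
    show "compact {r..r+1}" by simp
    fix x assume "x \<notin> {r..r+1}"
    then consider "x < r" | "r + 1 < x" by fastforce
    then have "real (Suc n) * (x - r) \<notin> {0..1}"
    proof cases
      case 1
      then show ?thesis by (simp add: not_le mult_pos_neg del: of_nat_Suc)
    next
      case 2
      have "1 * (x - r) \<le> real (Suc n) * (x - r)" using 2 by (intro mult_right_mono) auto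
      moreover have "1 < 1 * (x - r)" using 2 by simp
      ultimately have "1 < real (Suc n) * (x - r)" by (rule less_le_trans[rotated])
      then show ?thesis by (simp del: of_nat_Suc)
    qed
    then show "f x * D r n x = 0" by (simp add: D_def step_deriv_eq_0)
  qed
  have "(LINT x|lebesgue. f x * partial_deriv 1 (\<phi> n) x)
      = (LINT x|lborel. f x * D s n x) - (LINT x|lborel. f x * D t n x)" for n
  proof -
    have "(LINT x|lebesgue. f x * partial_deriv 1 (\<phi> n) x)
        = (LINT x|lborel. f x * D s n x - f x * D t n x)"
      unfolding deriv right_diff_distrib
      by (rule integral_completion) (use D_int in \<open>auto intro!: borel_measurable_diff\<close>)
    also have "\<dots> = (LINT x|lborel. f x * D s n x) - (LINT x|lborel. f x * D t n x)"
      by (rule Bochner_Integration.integral_diff[OF D_int D_int])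
    finally show ?thesis .
  qed
  then have "(\<lambda>n. LINT x|lebesgue. f x * partial_deriv 1 (\<phi> n) x) \<longlonglongrightarrow> f s - f t"
    using tendsto_diff[OF step_deriv_concentrates[OF f, of s] step_deriv_concentrates[OF f, of t]]
    by (simp add: D_def)
  then have left: "(\<lambda>n. LINT x|lebesgue. f' x * \<phi> n x) \<longlonglongrightarrow> f t - f s"
    using weak test tendsto_minus[of _ "f s - f t"] unfolding has_weak_partial_def by fastforce
  have "set_integrable lebesgue {s..t+1} f'"
    using weak by (simp add: has_weak_partial_def locally_integrable_def)
  then have F: "integrable lebesgue (\<lambda>x. indicator {s..t+1} x * f' x)"
    by (simp add: set_integrable_def)
  have "(\<lambda>n. LINT x|lebesgue. (indicator {s..t+1} x * f' x) * \<phi> n x)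
      \<longlonglongrightarrow> (LINT x|lebesgue. (indicator {s..t+1} x * f' x) * indicator {s..t} x)"
  proof (rule integral_dominated_convergence[where w = "\<lambda>x. \<bar>indicator {s..t+1} x * f' x\<bar>"])
    show "integrable lebesgue (\<lambda>x. \<bar>indicator {s..t+1} x * f' x\<bar>)"
      using F by (rule integrable_abs)
    show "(\<lambda>x. (indicator {s..t+1} x * f' x) * indicator {s..t} x) \<in> borel_measurable lebesgue"
      using F by (intro borel_measurable_times[OF borel_measurable_integrable measurable_completion]) auto
    have "continuous_on UNIV (\<phi> n)" for n
      using test[of n] Ck_on.simps(1) unfolding test_function_def by blast
    then have "\<phi> n \<in> borel_measurable lebesgue" for n
      by (intro measurable_completion) (auto intro: borel_measurable_continuous_onI)
    then show "(\<lambda>x. (indicator {s..t+1} x * f' x) * \<phi> n x) \<in> borel_measurable lebesgue" for n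
      using F by (intro borel_measurable_times[OF borel_measurable_integrable])
    have "\<bar>\<phi> n x\<bar> \<le> 1" for n x
      using smooth_step_bounds[of "real (Suc n) * (x - s)"] smooth_step_bounds[of "real (Suc n) * (x - t)"]
      unfolding \<phi>_def by linarith
    then show "AE x in lebesgue. norm ((indicator {s..t+1} x * f' x) * \<phi> n x)
        \<le> \<bar>indicator {s..t+1} x * f' x\<bar>" for n
      by (intro AE_I2) (simp add: abs_mult mult_left_le)
    have ev1: "\<forall>\<^sub>F n in sequentially. smooth_step (real (Suc n) * (x - r)) = 1" if "r < x" for r x
    proof -
      obtain m where m: "inverse (x - r) < real m" using reals_Archimedean2 by blast
      show ?thesis
      proof (rule eventually_sequentiallyI)
        fix n assume "m \<le> n"
        then have "inverse (x - r) \<le> real (Suc n)" using m by linarith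
        with that have "1 \<le> real (Suc n) * (x - r)" by (simp add: field_simps del: of_nat_Suc)
        then show "smooth_step (real (Suc n) * (x - r)) = 1" by (rule smooth_step_right)
      qed
    qed
    have ev0: "smooth_step (real (Suc n) * (x - r)) = 0" if "x \<le> r" for r x n
      using that by (intro smooth_step_left) (simp add: mult_nonneg_nonpos del: of_nat_Suc)
    have lim: "(\<lambda>n. \<phi> n x) \<longlonglongrightarrow> indicator {s..t} x" if neq: "x \<noteq> s" for x
    proof -
      consider "x < s" | "s < x" "x \<le> t" | "t < x" using neq by linarith
      then have "\<forall>\<^sub>F n in sequentially. \<phi> n x = indicator {s..t} x"
      proof cases
        case 1
        with \<open>s < t\<close> show ?thesis by (simp add: \<phi>_def ev0 del: of_nat_Suc)
      next
        case 2
        show ?thesis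
          using ev1[OF 2(1)] by eventually_elim (use 2 in \<open>simp add: \<phi>_def ev0 del: of_nat_Suc\<close>)
      next
        case 3
        with \<open>s < t\<close> have "s < x" by simp
        show ?thesis
          using ev1[OF 3] ev1[OF \<open>s < x\<close>]
          by eventually_elim (use 3 in \<open>simp add: \<phi>_def del: of_nat_Suc\<close>)
      qed
      then show ?thesis by (rule tendsto_eventually)
    qed
    have "AE x in lebesgue. x \<noteq> s"
      by (intro AE_completion AE_lborel_singleton)
    then show "AE x in lebesgue. (\<lambda>n. (indicator {s..t+1} x * f' x) * \<phi> n x)
        \<longlonglongrightarrow> (indicator {s..t+1} x * f' x) * indicator {s..t} x"
      by eventually_elim (intro tendsto_mult tendsto_const lim)
  qed
  moreover have "(indicator {s..t+1} x * f' x) * \<phi> n x = f' x * \<phi> n x" for n x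
    using \<phi>_0[of x n] by (auto split: split_indicator)
  moreover have "(indicator {s..t+1} x * f' x) * indicator {s..t} x = indicator {s..t} x * f' x" for x
    by (auto split: split_indicator)
  ultimately have "(\<lambda>n. LINT x|lebesgue. f' x * \<phi> n x)
      \<longlonglongrightarrow> (LINT x|lebesgue. indicator {s..t} x * f' x)" by simp
  with left show ?thesis by (rule LIMSEQ_unique)
qed

text \<open>
  Composition with \<open>x \<mapsto> d \<bullet> x\<close> does not preserve almost everywhere statements: for \<open>d = 0\<close> it picks
  out the value at a single point. A Borel version of \<open>f'\<close>, truncated so that the bound holds
  everywhere, keeps its measurability and its bound under such compositions and has the same
  integrals.
\<close>
lemma bounded_borel_derivative:
  fixes f f' :: "real \<Rightarrow> real"
  assumes f: "continuous_on UNIV f" and weak: "has_weak_partial f 1 f'" and "Linf_norm f' < 1"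
  obtains g L where "g \<in> borel_measurable borel" "\<And>x. \<bar>g x\<bar> \<le> L" "L < 1"
    and "\<And>s t. s < t \<Longrightarrow> f t - f s = (LINT x|lborel. indicator {s..t} x * g x)"
proof -
  have AE_norm: "AE x in lebesgue. ereal \<bar>f' x\<bar> \<le> Linf_norm f'"
    unfolding Linf_norm_def by (rule esssup_AE)
  obtain L where L: "Linf_norm f' \<le> ereal L" "L < 1"
    using \<open>Linf_norm f' < 1\<close> by (cases "Linf_norm f'") (auto simp: one_ereal_def intro: that[of 0])
  have AE_L: "AE x in lebesgue. \<bar>f' x\<bar> \<le> L"
    using AE_norm by eventually_elim (use L in \<open>simp add: order_trans flip: ereal_less_eq(3)\<close>)
  \<comment> \<open>Needed for the truncation to lie in \<open>[-L, L]\<close>.\<close>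
  have "0 \<le> L"
  proof (rule ccontr)
    assume "\<not> 0 \<le> L"
    from AE_L have "AE x::real in lebesgue. False"
      by (rule eventually_mono) (use \<open>\<not> 0 \<le> L\<close> in auto)
    then have "AE x::real in lborel. False" by (simp add: AE_completion_iff)
    then show False by (simp add: ae_filter_eq_bot_iff flip: trivial_limit_def)
  qed
  have meas: "f' \<in> borel_measurable lebesgue"
  proof (rule borel_measurable_LIMSEQ_real)
    show "(\<lambda>x. indicator {- real n..real n} x * f' x) \<in> borel_measurable lebesgue" for n
      using weak by (auto simp: has_weak_partial_def locally_integrable_def set_integrable_def
          dest!: spec[of _ "{- real n..real n}"])
    fix x
    obtain m where "\<bar>x\<bar> \<le> real m" using real_arch_simple by blast
    then have "\<forall>\<^sub>F n in sequentially. indicator {- real n..real n} x * f' x = f' x"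
      by (intro eventually_sequentiallyI[of m]) (auto simp: indicator_def)
    then show "(\<lambda>n. indicator {- real n..real n} x * f' x) \<longlonglongrightarrow> f' x"
      by (rule tendsto_eventually)
  qed
  then obtain g0 where g0: "g0 \<in> borel_measurable lborel" "AE x in lborel. f' x = g0 x"
    using completion_ex_borel_measurable_real by blast
  define g where "g = (\<lambda>x. max (- L) (min L (g0 x)))"
  show thesis
  proof (rule that[of g L])
    show g: "g \<in> borel_measurable borel" using g0(1) unfolding g_def by simp
    show "\<bar>g x\<bar> \<le> L" for x using \<open>0 \<le> L\<close> by (auto simp: g_def)
    show "L < 1" by fact
    have AE_eq: "AE x in lebesgue. f' x = g x"
      using AE_completion[OF g0(2)] AE_L by eventually_elim (auto simp: g_def)
    fix s t :: real assume "s < t"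
    have "f t - f s = (LINT x|lebesgue. indicator {s..t} x * f' x)"
      by (rule weak_derivative_integral[OF f weak \<open>s < t\<close>])
    also have "\<dots> = (LINT x|lebesgue. indicator {s..t} x * g x)"
    proof (rule integral_cong_AE)
      show "(\<lambda>x. indicator {s..t} x * f' x) \<in> borel_measurable lebesgue"
        using meas by (intro borel_measurable_times[OF measurable_completion]) auto
      show "(\<lambda>x. indicator {s..t} x * g x) \<in> borel_measurable lebesgue"
        using g by (intro measurable_completion) auto
      show "AE x in lebesgue. indicator {s..t} x * f' x = indicator {s..t} x * g x"
        using AE_eq by eventually_elim simp
    qed
    also have "\<dots> = (LINT x|lborel. indicator {s..t} x * g x)"
      using g by (intro integral_completion) auto
    finally show "f t - f s = (LINT x|lborel. indicator {s..t} x * g x)" .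
  qed
qed

section \<open>Weak partial derivatives from line integrals\<close>

lemma has_real_derivative_partial_deriv_line:
  fixes \<phi> :: "'a::euclidean_space \<Rightarrow> real"
  assumes "\<phi> differentiable at (x + s *\<^sub>R e)"
  shows "((\<lambda>s. \<phi> (x + s *\<^sub>R e)) has_real_derivative partial_deriv e \<phi> (x + s *\<^sub>R e)) (at s)"
proof -
  have 1: "(\<phi> has_derivative frechet_derivative \<phi> (at (x + s *\<^sub>R e))) (at (x + s *\<^sub>R e))"
    using assms by (simp add: frechet_derivative_works)
  have 2: "((\<lambda>s. x + s *\<^sub>R e) has_derivative (\<lambda>s. s *\<^sub>R e)) (at s)"
    by (auto intro!: derivative_eq_intros)
  have "((\<lambda>s. \<phi> (x + s *\<^sub>R e)) has_derivative
      (\<lambda>h. frechet_derivative \<phi> (at (x + s *\<^sub>R e)) (h *\<^sub>R e))) (at s)"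
    using has_derivative_compose[OF 2 1] by simp
  then show ?thesis
    unfolding has_field_derivative_def partial_deriv_def
    by (simp add: linear_scale[OF linear_frechet_derivative[OF assms]] mult_commute_abs)
qed

lemma partial_deriv_eq_gradient_inner:
  fixes \<phi> :: "'a::euclidean_space \<Rightarrow> real"
  assumes "\<phi> differentiable at x"
  shows "partial_deriv v \<phi> x = gradient \<phi> x \<bullet> v"
proof -
  have lin: "linear (frechet_derivative \<phi> (at x))"
    using assms by (rule linear_frechet_derivative)
  have "partial_deriv v \<phi> x = frechet_derivative \<phi> (at x) (\<Sum>i\<in>Basis. (v \<bullet> i) *\<^sub>R i)"
    by (simp add: partial_deriv_def euclidean_representation)
  also have "\<dots> = (\<Sum>i\<in>Basis. (v \<bullet> i) * partial_deriv i \<phi> x)"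
    by (simp add: linear_sum[OF lin] linear_scale[OF lin] partial_deriv_def)
  also have "\<dots> = gradient \<phi> x \<bullet> v"
    by (simp add: gradient_def inner_sum_left inner_commute[of v] mult.commute)
  finally show ?thesis .
qed

lemma has_real_derivative_gradient_line:
  fixes \<phi> :: "'a::euclidean_space \<Rightarrow> real"
  assumes "\<phi> differentiable at (x + s *\<^sub>R v)"
  shows "((\<lambda>s. \<phi> (x + s *\<^sub>R v)) has_real_derivative gradient \<phi> (x + s *\<^sub>R v) \<bullet> v) (at s)"
  using has_real_derivative_partial_deriv_line[OF assms] partial_deriv_eq_gradient_inner[OF assms, of v]
  by simp

lemma borel_bounded_on_compact_imp_locally_integrable:
  fixes h :: "'a::euclidean_space \<Rightarrow> real"
  assumes h: "h \<in> borel_measurable borel"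
    and bd: "\<And>K. compact K \<Longrightarrow> \<exists>B. \<forall>x\<in>K. \<bar>h x\<bar> \<le> B"
  shows "locally_integrable h"
  unfolding locally_integrable_def set_integrable_def
proof (intro allI impI)
  fix K :: "'a set" assume K: "compact K"
  obtain B where "\<forall>x\<in>K. \<bar>h x\<bar> \<le> B" using bd[OF K] by blast
  moreover have meas: "(\<lambda>x. indicator K x *\<^sub>R h x) \<in> borel_measurable borel"
    using h borel_compact[OF K] by (intro borel_measurable_scaleR borel_measurable_indicator)
  ultimately have "integrable lborel (\<lambda>x. indicator K x *\<^sub>R h x)"
    by (intro integrable_lborel_compact_support[OF _ K, of _ B]) auto
  then show "integrable lebesgue (\<lambda>x. indicator K x *\<^sub>R h x)"
    using meas by (subst integrable_completion) auto
qed

lemma borel_bounded_on_compact_imp_Linf_loc: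
  fixes h :: "'a::euclidean_space \<Rightarrow> real"
  assumes h: "h \<in> borel_measurable borel"
    and bd: "\<And>K. compact K \<Longrightarrow> \<exists>B. \<forall>x\<in>K. \<bar>h x\<bar> \<le> B"
  shows "Linf_loc h"
  unfolding Linf_loc_def
proof (intro conjI allI impI)
  show "h \<in> borel_measurable lebesgue" using h by (intro measurable_completion) simp
  fix K :: "'a set" assume K: "compact K"
  obtain B where B: "\<forall>x\<in>K. \<bar>h x\<bar> \<le> B" using bd[OF K] by blast
  have "Linf_norm (\<lambda>x. indicator K x * h x) \<le> ereal \<bar>B\<bar>"
    unfolding Linf_norm_def
  proof (rule esssup_I)
    show "(\<lambda>x. ereal \<bar>indicator K x * h x\<bar>) \<in> borel_measurable lebesgue"
      using h borel_compact[OF K] by (intro measurable_completion) simp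
    show "AE x in lebesgue. ereal \<bar>indicator K x * h x\<bar> \<le> ereal \<bar>B\<bar>"
      by (intro AE_I2) (use B in \<open>force split: split_indicator\<close>)
  qed
  also have "\<dots> < \<infinity>" by simp
  finally show "Linf_norm (\<lambda>x. indicator K x * h x) < \<infinity>" .
qed

lemma lborel_integral_translation:
  fixes h :: "'a::euclidean_space \<Rightarrow> real"
  assumes "h \<in> borel_measurable borel"
  shows "(LINT x|lborel. h (c + x)) = (LINT x|lborel. h x)"
proof -
  have "(LINT x|lborel. h x) = (LINT x|distr lborel borel ((+) c). h x)"
    by (simp add: lborel_distr_plus)
  also have "\<dots> = (LINT x|lborel. h (c + x))"
    by (rule integral_distr) (use assms in auto)
  finally show ?thesis by simp
qed

text \<open>
  A discrete integration by parts. Moving a difference quotient from \<open>u\<close> to \<open>\<phi>\<close> is a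
  translation of the integral and costs no regularity. By hypothesis the difference quotient of \<open>u\<close>
  with step \<open>h\<close> is the average of \<open>v\<close> over a segment of length \<open>h\<close>. Fubini's theorem and a second
  translation move that averaging onto \<open>\<phi>\<close> as well: it becomes the average of
  \<open>J r = \<integral> v(x) \<phi>(x - r e) dx\<close> over \<open>0 \<le> r \<le> h\<close>. Only the continuity of \<open>J\<close> at 0 is then used,
  which comes from \<open>\<phi>\<close>.
\<close>
lemma has_weak_partial_of_line_integrals:
  fixes u v :: "'a::euclidean_space \<Rightarrow> real"
  assumes u: "continuous_on UNIV u" and v[measurable]: "v \<in> borel_measurable borel"
    and v_bound: "\<And>x. \<bar>v x\<bar> \<le> B" and e: "e \<in> Basis"
    and line: "\<And>x h. 0 < h \<Longrightarrow>
      u (x + h *\<^sub>R e) - u x = h * (LINT s|lborel. indicator {0..1} s * v (x + (s * h) *\<^sub>R e))"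
  shows "has_weak_partial u e v"
  unfolding has_weak_partial_def
proof (intro conjI allI impI)
  show "locally_integrable u"
    using u continuous_on_bounded_on_compact[OF u]
    by (intro borel_bounded_on_compact_imp_locally_integrable borel_measurable_continuous_onI) metis+
  show "locally_integrable v"
    using v v_bound by (intro borel_bounded_on_compact_imp_locally_integrable) blast+
next
  fix \<phi> :: "'a \<Rightarrow> real"
  assume "test_function \<phi>"
  then obtain K where Ck: "\<And>k. Ck_on k UNIV \<phi>" and K: "compact K" "\<And>x. x \<notin> K \<Longrightarrow> \<phi> x = 0"
    by (auto simp: test_function_def)
  have \<phi>: "continuous_on UNIV \<phi>" using Ck[of 0] by simp
  have diff: "\<phi> differentiable at x" for x using Ck[of "Suc 0"] by simp
  have \<phi>': "continuous_on UNIV (partial_deriv e \<phi>)" using Ck[of "Suc 0"] e by simp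
  note [measurable] = u[THEN borel_measurable_continuous_onI]
    \<phi>[THEN borel_measurable_continuous_onI] \<phi>'[THEN borel_measurable_continuous_onI]
  obtain R where R: "\<And>x. x \<in> K \<Longrightarrow> norm x \<le> R"
    using compact_imp_bounded[OF K(1)] by (auto simp: bounded_iff)
  \<comment> \<open>The radius is enlarged by 1 because \<open>\<phi>\<close> is translated by at most one unit vector.\<close>
  define Q where "Q = cball (0::'a) (R + 1)"
  have Q: "compact Q" by (simp add: Q_def)
  have [measurable]: "Q \<in> sets borel" by (simp add: Q_def)
  have norm_e: "norm e = 1" using e by simp
  have \<phi>_Q: "\<phi> (x - r *\<^sub>R e) = 0" if "x \<notin> Q" "0 \<le> r" "r \<le> 1" for x r
  proof (rule K(2), rule notI)
    assume "x - r *\<^sub>R e \<in> K"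
    then have "norm (x - r *\<^sub>R e) \<le> R" by (rule R)
    moreover have "norm x \<le> norm (x - r *\<^sub>R e) + norm (r *\<^sub>R e)"
      by (metis diff_add_cancel norm_triangle_ineq)
    ultimately show False using that norm_e by (simp add: Q_def)
  qed
  have \<phi>'_Q: "partial_deriv e \<phi> x = 0" if "x \<notin> Q" for x
  proof -
    have "\<phi> y = 0" if "y \<in> - Q" for y using \<phi>_Q[of y 0] that by simp
    moreover have "open (- Q)" using Q by (simp add: compact_imp_closed open_Compl)
    ultimately have "(\<phi> has_derivative (\<lambda>_. 0)) (at x)"
      using that by (intro has_derivative_transform_within_open[OF has_derivative_const, of "- Q"]) auto
    then show ?thesis unfolding partial_deriv_def by (metis frechet_derivative_at)
  qed
  obtain M where M: "\<And>x. \<bar>partial_deriv e \<phi> x\<bar> \<le> M"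
  proof -
    obtain M where "\<And>x. x \<in> Q \<Longrightarrow> \<bar>partial_deriv e \<phi> x\<bar> \<le> M"
      using continuous_on_bounded_on_compact[OF \<phi>' Q] by blast
    then have "\<bar>partial_deriv e \<phi> x\<bar> \<le> max M 0" for x
      using \<phi>'_Q[of x] by (cases "x \<in> Q") (auto simp: le_max_iff_disj)
    then show ?thesis by (rule that)
  qed
  have lip: "\<bar>\<phi> x - \<phi> (x - r *\<^sub>R e)\<bar> \<le> M * r" if "0 < r" for x r
  proof -
    have "((\<lambda>s. \<phi> (x + s *\<^sub>R e)) has_real_derivative partial_deriv e \<phi> (x + s *\<^sub>R e)) (at s)" for s
      by (rule has_real_derivative_partial_deriv_line[OF diff])
    with MVT2[of "- r" 0 "\<lambda>s. \<phi> (x + s *\<^sub>R e)" "\<lambda>s. partial_deriv e \<phi> (x + s *\<^sub>R e)"] that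
    obtain z where "\<phi> (x + 0 *\<^sub>R e) - \<phi> (x + (- r) *\<^sub>R e) = (0 - (- r)) * partial_deriv e \<phi> (x + z *\<^sub>R e)"
      by (meson neg_less_0_iff_less)
    then have "\<bar>\<phi> x - \<phi> (x - r *\<^sub>R e)\<bar> = r * \<bar>partial_deriv e \<phi> (x + z *\<^sub>R e)\<bar>"
      using that by (simp add: abs_mult)
    also have "\<dots> \<le> r * M" using M that by (intro mult_left_mono) auto
    finally show ?thesis by (simp add: mult.commute)
  qed
  define h where "h = (\<lambda>n. inverse (real (Suc n)))"
  have h: "0 < h n" "h n \<le> 1" "h n \<noteq> 0" for n by (simp_all add: h_def field_simps)
  have h_lim: "h \<longlonglongrightarrow> 0" unfolding h_def by (rule LIMSEQ_inverse_real_of_nat)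
  obtain U where U: "\<And>x. x \<in> Q \<Longrightarrow> \<bar>u x\<bar> \<le> U"
    using continuous_on_bounded_on_compact[OF u Q] by blast
  have Q_int: "integrable lborel (\<lambda>x. indicator Q x * c)" for c :: real
    by (intro integrable_lborel_compact_support[OF _ Q, of _ "\<bar>c\<bar>"]) auto

  have left: "(\<lambda>n. LINT x|lborel. u x * ((\<phi> x - \<phi> (x - h n *\<^sub>R e)) / h n))
      \<longlonglongrightarrow> (LINT x|lborel. u x * partial_deriv e \<phi> x)"
  proof (rule integral_dominated_convergence[where w = "\<lambda>x. indicator Q x * (U * M)"])
    show "integrable lborel (\<lambda>x. indicator Q x * (U * M))" by (rule Q_int)
    show "AE x in lborel. norm (u x * ((\<phi> x - \<phi> (x - h n *\<^sub>R e)) / h n)) \<le> indicator Q x * (U * M)" for n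
    proof (rule AE_I2)
      fix x
      show "norm (u x * ((\<phi> x - \<phi> (x - h n *\<^sub>R e)) / h n)) \<le> indicator Q x * (U * M)"
      proof (cases "x \<in> Q")
        case True
        have "\<bar>(\<phi> x - \<phi> (x - h n *\<^sub>R e)) / h n\<bar> \<le> M"
          using lip[OF h(1), of x n] h[of n] by (simp add: field_simps)
        then have "\<bar>u x\<bar> * \<bar>(\<phi> x - \<phi> (x - h n *\<^sub>R e)) / h n\<bar> \<le> U * M"
          using U[OF True] by (intro mult_mono) auto
        with True show ?thesis by (simp add: abs_mult)
      next
        case False
        with \<phi>_Q[of x 0] \<phi>_Q[of x "h n"] h[of n] show ?thesis by simp
      qed
    qed
    show "AE x in lborel. (\<lambda>n. u x * ((\<phi> x - \<phi> (x - h n *\<^sub>R e)) / h n)) \<longlonglongrightarrow> u x * partial_deriv e \<phi> x"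
    proof (intro AE_I2 tendsto_mult tendsto_const)
      fix x
      have "((\<lambda>r. (\<phi> (x + (0 + r) *\<^sub>R e) - \<phi> (x + 0 *\<^sub>R e)) / r) \<longlongrightarrow> partial_deriv e \<phi> (x + 0 *\<^sub>R e)) (at 0)"
        using has_real_derivative_partial_deriv_line[of \<phi> x 0 e, OF diff] unfolding DERIV_def .
      then have *: "((\<lambda>r. (\<phi> (x + r *\<^sub>R e) - \<phi> x) / r) \<longlongrightarrow> partial_deriv e \<phi> x) (at 0)" by simp
      have "filterlim (\<lambda>n. - h n) (at 0) sequentially"
        using tendsto_minus[OF h_lim] h by (simp add: filterlim_at)
      from filterlim_compose[OF * this]
      show "(\<lambda>n. (\<phi> x - \<phi> (x - h n *\<^sub>R e)) / h n) \<longlonglongrightarrow> partial_deriv e \<phi> x"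
        by (simp add: minus_divide_left)
    qed
  qed measurable

  define J where "J = (\<lambda>r. LINT x|lborel. v x * \<phi> (x - r *\<^sub>R e))"
  obtain P where P: "\<And>x. \<bar>\<phi> x\<bar> \<le> P"
  proof -
    obtain P where "\<And>x. x \<in> K \<Longrightarrow> \<bar>\<phi> x\<bar> \<le> P"
      using continuous_on_bounded_on_compact[OF \<phi> K(1)] by blast
    then have "\<bar>\<phi> x\<bar> \<le> max P 0" for x
      using K(2)[of x] by (cases "x \<in> K") (auto simp: le_max_iff_disj)
    then show ?thesis by (rule that)
  qed
  have v\<phi>_bound: "\<bar>v y * \<phi> z\<bar> \<le> B * P" for y z
    using mult_mono[OF v_bound[of y] P[of z]] order_trans[OF abs_ge_zero v_bound[of y]] by (simp add: abs_mult)
  have J_int: "integrable lborel (\<lambda>x. v x * \<phi> (x - r *\<^sub>R e))" if "0 \<le> r" "r \<le> 1" for r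
    by (rule integrable_lborel_compact_support[OF _ Q, of _ "B * P"])
      (use v\<phi>_bound \<phi>_Q that in auto)
  define C where "C = (LINT x|lborel. indicator Q x * (B * M))"
  have J_lip: "\<bar>J r - J 0\<bar> \<le> C * r" if r: "0 < r" "r \<le> 1" for r
  proof -
    have "\<bar>J r - J 0\<bar> = \<bar>LINT x|lborel. v x * \<phi> (x - r *\<^sub>R e) - v x * \<phi> x\<bar>"
      unfolding J_def using J_int[of r] J_int[of 0] r by simp
    also have "\<dots> \<le> (LINT x|lborel. \<bar>v x * \<phi> (x - r *\<^sub>R e) - v x * \<phi> x\<bar>)"
      by (rule integral_abs_bound)
    also have "\<dots> \<le> (LINT x|lborel. indicator Q x * (B * M) * r)"
    proof (rule integral_mono)
      show "integrable lborel (\<lambda>x. \<bar>v x * \<phi> (x - r *\<^sub>R e) - v x * \<phi> x\<bar>)"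
        using J_int[of r] J_int[of 0] r by (intro integrable_abs Bochner_Integration.integrable_diff) auto
      show "integrable lborel (\<lambda>x. indicator Q x * (B * M) * r)" by (intro integrable_mult_left Q_int)
      fix x
      show "\<bar>v x * \<phi> (x - r *\<^sub>R e) - v x * \<phi> x\<bar> \<le> indicator Q x * (B * M) * r"
      proof (cases "x \<in> Q")
        case True
        have "\<bar>v x\<bar> * \<bar>\<phi> x - \<phi> (x - r *\<^sub>R e)\<bar> \<le> B * (M * r)"
          using v_bound[of x] lip[OF r(1), of x] by (intro mult_mono) auto
        with True show ?thesis
          by (simp add: abs_mult abs_minus_commute mult.assoc flip: right_diff_distrib)
      next
        case False
        with \<phi>_Q[of x 0] \<phi>_Q[of x r] r show ?thesis by simp
      qed
    qed
    also have "\<dots> = C * r" by (simp add: C_def)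
    finally show ?thesis .
  qed
  have J_meas[measurable]: "J \<in> borel_measurable borel" unfolding J_def by measurable

  \<comment> \<open>The two translations and the exchange of integrals described above.\<close>
  have fubini: "(LINT x|lborel. u x * ((\<phi> x - \<phi> (x - h n *\<^sub>R e)) / h n))
      = - (LINT s|lborel. indicator {0..1} s * J (s * h n))" for n
  proof -
    have u\<phi>_int: "integrable lborel (\<lambda>x. u (x + a *\<^sub>R e) * \<phi> (x - r *\<^sub>R e) / h n)" if "0 \<le> r" "r \<le> 1" for r a
      using that h(3)[of n] by (intro integrable_continuous_compact_support[OF _ Q] continuous_intros
          continuous_on_compose2[OF u] continuous_on_compose2[OF \<phi>]) (auto simp: \<phi>_Q)
    have "(LINT x|lborel. u x * ((\<phi> x - \<phi> (x - h n *\<^sub>R e)) / h n))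
        = (LINT x|lborel. u x * \<phi> x / h n) - (LINT x|lborel. u x * \<phi> (x - h n *\<^sub>R e) / h n)"
      using u\<phi>_int[of 0 0] u\<phi>_int[of "h n" 0] h[of n]
      by (subst Bochner_Integration.integral_diff[symmetric]) (auto simp: right_diff_distrib diff_divide_distrib)
    also have "(LINT x|lborel. u x * \<phi> (x - h n *\<^sub>R e) / h n)
        = (LINT x|lborel. u (h n *\<^sub>R e + x) * \<phi> (h n *\<^sub>R e + x - h n *\<^sub>R e) / h n)"
      by (rule lborel_integral_translation[symmetric]) measurable
    also have "(LINT x|lborel. u x * \<phi> x / h n) - \<dots>
        = - (LINT x|lborel. (u (x + h n *\<^sub>R e) - u x) / h n * \<phi> x)"
      using u\<phi>_int[of 0 0] u\<phi>_int[of 0 "h n"]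
      by (subst Bochner_Integration.integral_diff[symmetric])
        (auto simp: algebra_simps diff_divide_distrib simp flip: Bochner_Integration.integral_minus)
    also have "(LINT x|lborel. (u (x + h n *\<^sub>R e) - u x) / h n * \<phi> x)
        = (LINT x|lborel. LINT s|lborel. indicator {0..1} s * v (x + (s * h n) *\<^sub>R e) * \<phi> x)"
      using line[OF h(1)] h by simp
    also have "\<dots> = (LINT s|lborel. LINT x|lborel. indicator {0..1} s * v (x + (s * h n) *\<^sub>R e) * \<phi> x)"
    proof (rule lborel_pair.Fubini_integral[symmetric])
      show "integrable (lborel \<Otimes>\<^sub>M lborel)
          (\<lambda>(x, s). indicator {0..1} s * v (x + (s * h n) *\<^sub>R e) * \<phi> x)"
        unfolding lborel_prod
      proof (rule integrable_lborel_compact_support)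
        have "(\<lambda>p::'a \<times> real. indicator {0..1} (snd p) * v (fst p + (snd p * h n) *\<^sub>R e) * \<phi> (fst p))
            \<in> borel_measurable (borel \<Otimes>\<^sub>M borel)"
          by measurable
        then show "(\<lambda>(x, s). indicator {0..1} s * v (x + (s * h n) *\<^sub>R e) * \<phi> x) \<in> borel_measurable borel"
          by (simp add: borel_prod split_beta')
        show "compact (Q \<times> {0..1::real})" using Q by (intro compact_Times) auto
        have "0 \<le> B * P" using v\<phi>_bound[of 0 0] by linarith
        then show "\<bar>case p of (x, s) \<Rightarrow> indicator {0..1} s * v (x + (s * h n) *\<^sub>R e) * \<phi> x\<bar> \<le> B * P" for p
          using v\<phi>_bound by (auto split: split_indicator prod.split)
        show "(case p of (x, s) \<Rightarrow> indicator {0..1} s * v (x + (s * h n) *\<^sub>R e) * \<phi> x) = 0"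
          if "p \<notin> Q \<times> {0..1}" for p
          using that \<phi>_Q[of "fst p" 0] by (cases p) (auto split: split_indicator)
      qed
    qed
    also have "\<dots> = (LINT s|lborel. indicator {0..1} s * J (s * h n))"
    proof (intro Bochner_Integration.integral_cong refl)
      fix s
      have "(LINT x|lborel. v (x + (s * h n) *\<^sub>R e) * \<phi> x)
          = (LINT x|lborel. v ((s * h n) *\<^sub>R e + x) * \<phi> ((s * h n) *\<^sub>R e + x - (s * h n) *\<^sub>R e))"
        by (simp add: add.commute)
      also have "\<dots> = J (s * h n)"
        unfolding J_def by (rule lborel_integral_translation) measurable
      finally show "(LINT x|lborel. indicator {0..1} s * v (x + (s * h n) *\<^sub>R e) * \<phi> x)
          = indicator {0..1} s * J (s * h n)"
        by (simp add: mult.assoc)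
    qed
    finally show ?thesis .
  qed
  have right: "(\<lambda>n. LINT s|lborel. indicator {0..1} s * J (s * h n))
      \<longlonglongrightarrow> (LINT s|lborel. indicator {0..1::real} s * J 0)"
  proof (rule integral_dominated_convergence[where w = "\<lambda>s. indicator {0..1} s * (\<bar>J 0\<bar> + C)"])
    have C0: "0 \<le> C" using J_lip[of 1] by linarith
    have J_close: "\<bar>J (s * h n) - J 0\<bar> \<le> C * h n" if s: "s \<in> {0..1}" for s n
    proof (cases "s = 0")
      case False
      with s have "0 < s" "s \<le> 1" by auto
      then have "0 < s * h n" "s * h n \<le> h n" using h[of n] by (auto simp: mult_left_le_one_le)
      then have "\<bar>J (s * h n) - J 0\<bar> \<le> C * (s * h n)"
        using h(2)[of n] by (intro J_lip order_trans[OF \<open>s * h n \<le> h n\<close>])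
      also have "\<dots> \<le> C * h n" using \<open>s * h n \<le> h n\<close> C0 by (intro mult_left_mono)
      finally show ?thesis .
    qed (use C0 h[of n] in simp)
    show "integrable lborel (\<lambda>s. indicator {0..1::real} s * (\<bar>J 0\<bar> + C))"
      by (rule integrable_lborel_compact_support[of _ "{0..1}" "\<bar>J 0\<bar> + C"]) (use C0 in auto)
    show "AE s in lborel. norm (indicator {0..1} s * J (s * h n)) \<le> indicator {0..1} s * (\<bar>J 0\<bar> + C)" for n
    proof (rule AE_I2)
      fix s :: real
      have "C * h n \<le> C * 1" using C0 h[of n] by (intro mult_left_mono) auto
      then show "norm (indicator {0..1} s * J (s * h n)) \<le> indicator {0..1} s * (\<bar>J 0\<bar> + C)"
        using J_close[of s n] by (auto split: split_indicator)
    qed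
    show "AE s in lborel. (\<lambda>n. indicator {0..1} s * J (s * h n)) \<longlonglongrightarrow> indicator {0..1} s * J 0"
    proof (rule AE_I2)
      fix s :: real
      show "(\<lambda>n. indicator {0..1} s * J (s * h n)) \<longlonglongrightarrow> indicator {0..1} s * J 0"
      proof (cases "s \<in> {0..1}")
        case True
        have "(\<lambda>n. C * h n) \<longlonglongrightarrow> C * 0" by (intro tendsto_intros h_lim)
        then have "(\<lambda>n. C * h n) \<longlonglongrightarrow> 0" by simp
        then have "(\<lambda>n. J (s * h n) - J 0) \<longlonglongrightarrow> 0"
          by (rule Lim_null_comparison[rotated]) (simp add: J_close[OF True])
        then have "(\<lambda>n. J (s * h n)) \<longlonglongrightarrow> J 0" by (simp add: LIM_zero_iff)
        with True show ?thesis by simp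
      qed simp
    qed
  qed measurable
  have "(LINT s|lborel. indicator {0..1::real} s * J 0) = J 0" by simp
  with tendsto_minus[OF right] left have "(LINT x|lborel. u x * partial_deriv e \<phi> x) = - J 0"
    unfolding fubini by (simp add: LIMSEQ_unique)
  moreover have "(LINT x|lebesgue. u x * partial_deriv e \<phi> x) = (LINT x|lborel. u x * partial_deriv e \<phi> x)"
    by (rule integral_completion) measurable
  moreover have "(LINT x|lebesgue. v x * \<phi> x) = (LINT x|lborel. v x * \<phi> x)"
    by (rule integral_completion) measurable
  ultimately show "(LINT x|lebesgue. u x * partial_deriv e \<phi> x) = - (LINT x|lebesgue. v x * \<phi> x)"
    by (simp add: J_def)
qed

text \<open>
  Stated for increments of either sign because \<open>\<delta>\<close> will be \<open>h (d \<bullet> i)\<close>, where the component of \<open>d\<close>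
  can be negative or zero.
\<close>
lemma increment_as_segment_average:
  fixes f g :: "real \<Rightarrow> real"
  assumes ftc: "\<And>s t. s < t \<Longrightarrow> f t - f s = (LINT x|lborel. indicator {s..t} x * g x)"
  shows "f (\<tau> + \<delta>) - f \<tau> = \<delta> * (LINT s|lborel. indicator {0..1} s * g (\<tau> + s * \<delta>))"
proof (cases "\<delta> = 0")
  case False
  have subst: "(LINT x|lborel. indicator S x * g x)
      = \<bar>\<delta>\<bar> * (LINT s|lborel. indicator {0..1} s * g (\<tau> + s * \<delta>))"
    if "\<And>s. \<tau> + \<delta> * s \<in> S \<longleftrightarrow> s \<in> {0..1}" for S
    using lborel_integral_real_affine[OF False, of "\<lambda>x. indicator S x * g x" \<tau>] that
    by (simp add: indicator_def mult.commute[of \<delta>])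
  consider "0 < \<delta>" | "\<delta> < 0" using False by linarith
  then show ?thesis
  proof cases
    case 1
    have "\<tau> + \<delta> * s \<in> {\<tau>..\<tau> + \<delta>} \<longleftrightarrow> s \<in> {0..1}" for s
      using 1 by (simp add: zero_le_mult_iff)
    from subst[OF this] ftc[of \<tau> "\<tau> + \<delta>"] 1 show ?thesis by simp
  next
    case 2
    have "\<tau> + \<delta> * s \<in> {\<tau> + \<delta>..\<tau>} \<longleftrightarrow> s \<in> {0..1}" for s
      using 2 by (auto simp: mult_le_0_iff mult_le_cancel_left1)
    from subst[OF this] ftc[of "\<tau> + \<delta>" \<tau>] 2 show ?thesis by simp
  qed
qed simp

lemma lipschitz_of_bounded_derivative:
  fixes f g :: "real \<Rightarrow> real"
  assumes g: "g \<in> borel_measurable borel" "\<And>x. \<bar>g x\<bar> \<le> L"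
    and ftc: "\<And>s t. s < t \<Longrightarrow> f t - f s = (LINT x|lborel. indicator {s..t} x * g x)"
  shows "\<bar>f s - f t\<bar> \<le> L * \<bar>s - t\<bar>"
proof -
  have L: "0 \<le> L" using g(2)[of 0] by linarith
  have "\<bar>LINT r|lborel. indicator {0..1} r * g (t + r * (s - t))\<bar>
      \<le> (LINT r|lborel. \<bar>indicator {0..1} r * g (t + r * (s - t))\<bar>)"
    by (rule integral_abs_bound)
  also have "\<dots> \<le> (LINT r|lborel. indicator {0..1::real} r * L)"
  proof (rule integral_mono)
    show "integrable lborel (\<lambda>r. \<bar>indicator {0..1} r * g (t + r * (s - t))\<bar>)"
      using g by (intro integrable_lborel_compact_support[of _ "{0..1}" L])
        (auto split: split_indicator)
    show "integrable lborel (\<lambda>r. indicator {0..1::real} r * L)"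
      using L by (intro integrable_lborel_compact_support[of _ "{0..1}" L]) auto
  qed (use g(2) in \<open>auto split: split_indicator\<close>)
  also have "\<dots> = L" by simp
  finally have "\<bar>s - t\<bar> * \<bar>LINT r|lborel. indicator {0..1} r * g (t + r * (s - t))\<bar> \<le> \<bar>s - t\<bar> * L"
    by (rule mult_left_mono) simp
  then show ?thesis
    using increment_as_segment_average[OF ftc, where \<tau>=t and \<delta>="s - t"] by (simp add: abs_mult mult.commute)
qed

text \<open>
  On a line in the direction \<open>i\<close> the argument \<open>d \<bullet> x\<close> moves with speed \<open>d \<bullet> i\<close>, so the chain rule
  suggests the weak partial derivative \<open>c \<bullet> i + (d \<bullet> i) g (d \<bullet> x)\<close>. The representation of \<open>f\<close>
  as an integral of \<open>g\<close> verifies it on each line.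
\<close>
lemma W1inf_loc_plane_wave:
  fixes c d :: "'a::euclidean_space"
  assumes f: "continuous_on UNIV f"
    and g[measurable]: "g \<in> borel_measurable borel" and g_bound: "\<And>x. \<bar>g x\<bar> \<le> L"
    and ftc: "\<And>s t. s < t \<Longrightarrow> f t - f s = (LINT x|lborel. indicator {s..t} x * g x)"
  shows "W1inf_loc (\<lambda>x. c \<bullet> x + f (d \<bullet> x))"
  unfolding W1inf_loc_def
proof (intro conjI ballI)
  let ?u = "\<lambda>x. c \<bullet> x + f (d \<bullet> x)"
  have u: "continuous_on UNIV ?u"
    by (intro continuous_on_add continuous_on_compose2[OF f, of _ "\<lambda>x. d \<bullet> x"]
        continuous_on_inner continuous_on_const continuous_on_id subset_UNIV)
  show "Linf_loc ?u"
    using continuous_on_bounded_on_compact[OF u]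
    by (intro borel_bounded_on_compact_imp_Linf_loc borel_measurable_continuous_onI u) metis
  fix i :: 'a assume i: "i \<in> Basis"
  define v where "v = (\<lambda>x. c \<bullet> i + d \<bullet> i * g (d \<bullet> x))"
  have v_meas: "v \<in> borel_measurable borel" unfolding v_def by measurable
  have v_bound: "\<bar>v x\<bar> \<le> \<bar>c \<bullet> i\<bar> + \<bar>d \<bullet> i\<bar> * L" for x
  proof -
    have "\<bar>v x\<bar> \<le> \<bar>c \<bullet> i\<bar> + \<bar>d \<bullet> i\<bar> * \<bar>g (d \<bullet> x)\<bar>"
      unfolding v_def by (metis abs_mult abs_triangle_ineq)
    also have "\<dots> \<le> \<bar>c \<bullet> i\<bar> + \<bar>d \<bullet> i\<bar> * L"
      using g_bound by (intro add_left_mono mult_left_mono) auto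
    finally show ?thesis .
  qed
  have "has_weak_partial ?u i v"
  proof (rule has_weak_partial_of_line_integrals[OF u v_meas v_bound i])
    fix x h :: _ assume "0 < (h::real)"
    have int: "integrable lborel (\<lambda>s. indicator {0..1} s * g (d \<bullet> x + s * (h * (d \<bullet> i))))"
      using g_bound order_trans[OF abs_ge_zero g_bound]
      by (intro integrable_lborel_compact_support[of _ "{0..1}" L]) (auto split: split_indicator)
    have "integrable lborel (\<lambda>s. indicator {0..1::real} s * (c \<bullet> i))"
      by (intro integrable_lborel_compact_support[of _ "{0..1}" "\<bar>c \<bullet> i\<bar>"]) auto
    then have "(LINT s|lborel. indicator {0..1} s * v (x + (s * h) *\<^sub>R i))
        = c \<bullet> i + d \<bullet> i * (LINT s|lborel. indicator {0..1} s * g (d \<bullet> x + s * (h * (d \<bullet> i))))"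
      using integrable_mult_right[OF int, of "d \<bullet> i"]
      by (simp add: v_def inner_add_right distrib_left mult_ac
          flip: Bochner_Integration.integral_mult_right_zero)
    moreover have "f (d \<bullet> x + h * (d \<bullet> i)) - f (d \<bullet> x)
        = h * (d \<bullet> i) * (LINT s|lborel. indicator {0..1} s * g (d \<bullet> x + s * (h * (d \<bullet> i))))"
      by (rule increment_as_segment_average[OF ftc])
    ultimately show "?u (x + h *\<^sub>R i) - ?u x
        = h * (LINT s|lborel. indicator {0..1} s * v (x + (s * h) *\<^sub>R i))"
      by (simp add: inner_add_right distrib_left)
  qed
  moreover have "Linf_loc v"
    using v_meas v_bound by (intro borel_bounded_on_compact_imp_Linf_loc) blast+
  ultimately show "\<exists>g. Linf_loc g \<and> has_weak_partial ?u i g" by blast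
qed

section \<open>Test functions touching a plane wave\<close>

text \<open>
  A negative second derivative would make \<open>m'\<close> negative just to the right of 0, so \<open>m\<close> would
  decrease there.
\<close>
lemma second_derivative_nonneg_at_local_min:
  fixes m m' :: "real \<Rightarrow> real"
  assumes min: "\<forall>\<^sub>F s in nhds 0. m 0 \<le> m s"
    and m': "\<forall>\<^sub>F s in nhds 0. (m has_real_derivative m' s) (at s)"
    and m'': "(m' has_real_derivative D) (at 0)"
  shows "0 \<le> D"
proof (rule ccontr)
  assume "\<not> 0 \<le> D"
  then have "D < 0" by simp
  obtain e where "0 < e" and e: "\<And>s. \<bar>s\<bar> < e \<Longrightarrow> m 0 \<le> m s \<and> (m has_real_derivative m' s) (at s)"
    using eventually_conj[OF min m'] by (auto simp: eventually_nhds_metric dist_real_def)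
  have m'0: "m' 0 = 0"
    using e[of 0] e \<open>0 < e\<close> by (intro DERIV_local_min[of m "m' 0" 0 e]) auto
  obtain r where "0 < r" and r: "\<And>h. 0 < h \<Longrightarrow> h < r \<Longrightarrow> m' h < 0"
    using DERIV_neg_dec_right[OF m'' \<open>D < 0\<close>] m'0 by auto
  define h where "h = min e r / 2"
  have h: "0 < h" "h < e" "h < r" using \<open>0 < e\<close> \<open>0 < r\<close> by (auto simp: h_def min_def)
  obtain z where z: "0 < z" "z < h" "m h - m 0 = (h - 0) * m' z"
    using MVT2[of 0 h m m'] e h by force
  have "m h - m 0 < 0"
    using z r[of z] h by (simp add: mult_pos_neg)
  with e[of h] h show False by simp
qed

text \<open>
  Let \<open>w\<close> be the gradient of \<open>\<phi>\<close> minus \<open>c\<close>. In any direction \<open>v\<close> the function \<open>u x - c \<bullet> x\<close> changes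
  at rate at most \<open>L \<bar>d \<bullet> v\<bar>\<close>, and a function touching from one side inherits a one-sided bound on
  \<open>w \<bullet> v\<close>; using it for \<open>v\<close> and \<open>-v\<close> gives \<open>\<bar>w \<bullet> v\<bar> \<le> L \<bar>d \<bullet> v\<bar>\<close>. In particular \<open>w\<close> vanishes on the
  orthogonal complement of \<open>d\<close>, so it is a multiple of \<open>d\<close>, and \<open>v = d\<close> bounds the factor.
\<close>
lemma gradient_at_touching_point:
  fixes \<phi> :: "'a::euclidean_space \<Rightarrow> real"
  assumes u: "\<And>x. u x = c \<bullet> x + f (d \<bullet> x)"
    and lip: "\<And>s t. \<bar>f s - f t\<bar> \<le> L * \<bar>s - t\<bar>" and "0 \<le> L"
    and diff: "\<phi> differentiable at x0"
    and touch: "local_max_at (\<lambda>x. u x - \<phi> x) x0 \<or> local_min_at (\<lambda>x. u x - \<phi> x) x0"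
  obtains t where "\<bar>t\<bar> \<le> L" "gradient \<phi> x0 = c + t *\<^sub>R d"
proof -
  define w where "w = gradient \<phi> x0 - c"
  have line: "((\<lambda>s::real. x0 + s *\<^sub>R v) \<longlongrightarrow> x0) (nhds 0)" for v
    by (auto intro!: tendsto_eq_intros filterlim_ident)
  have f_line: "\<bar>f (d \<bullet> (x0 + s *\<^sub>R v)) - f (d \<bullet> x0)\<bar> \<le> L * \<bar>d \<bullet> v\<bar> * \<bar>s\<bar>" for s v
    using lip[of "d \<bullet> (x0 + s *\<^sub>R v)" "d \<bullet> x0"] by (simp add: inner_add_right abs_mult mult_ac)
  have quot: "((\<lambda>s. (\<phi> (x0 + s *\<^sub>R v) - \<phi> x0) / s - c \<bullet> v) \<longlongrightarrow> w \<bullet> v) (at_right 0)" for v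
  proof -
    have "((\<lambda>s. (\<phi> (x0 + (0 + s) *\<^sub>R v) - \<phi> (x0 + 0 *\<^sub>R v)) / s) \<longlongrightarrow> gradient \<phi> (x0 + 0 *\<^sub>R v) \<bullet> v) (at 0)"
      using has_real_derivative_gradient_line[of \<phi> x0 0 v] diff unfolding DERIV_def by simp
    then have "((\<lambda>s. (\<phi> (x0 + s *\<^sub>R v) - \<phi> x0) / s) \<longlongrightarrow> gradient \<phi> x0 \<bullet> v) (at_right 0)"
      by (simp add: filterlim_at_split)
    from tendsto_diff[OF this tendsto_const[of "c \<bullet> v"]] show ?thesis
      by (simp add: w_def inner_diff_left)
  qed
  have "\<bar>w \<bullet> v\<bar> \<le> L * \<bar>d \<bullet> v\<bar>" for v
    using touch
  proof
    assume "local_max_at (\<lambda>x. u x - \<phi> x) x0"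
    then have max: "\<forall>\<^sub>F x in nhds x0. u x - \<phi> x \<le> u x0 - \<phi> x0" by (simp add: local_max_at_def)
    have lower: "- (L * \<bar>d \<bullet> v\<bar>) \<le> w \<bullet> v" for v
    proof (rule tendsto_lowerbound[OF quot])
      show "\<forall>\<^sub>F s in at_right 0. - (L * \<bar>d \<bullet> v\<bar>) \<le> (\<phi> (x0 + s *\<^sub>R v) - \<phi> x0) / s - c \<bullet> v"
        using eventually_compose_filterlim[OF max line[of v]] unfolding eventually_at_filter
      proof eventually_elim
        case (elim s)
        show ?case
        proof (intro impI)
          assume "s \<noteq> 0" "s \<in> {0<..}"
          then have "0 < s" by simp
          have "s * (c \<bullet> v) - L * \<bar>d \<bullet> v\<bar> * s \<le> \<phi> (x0 + s *\<^sub>R v) - \<phi> x0"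
            using elim f_line[of s v] \<open>0 < s\<close> by (simp add: u inner_add_right)
          with \<open>0 < s\<close> show "- (L * \<bar>d \<bullet> v\<bar>) \<le> (\<phi> (x0 + s *\<^sub>R v) - \<phi> x0) / s - c \<bullet> v"
            by (simp add: field_simps)
        qed
      qed
    qed simp
    from lower[of v] lower[of "-v"] show ?thesis by simp
  next
    assume "local_min_at (\<lambda>x. u x - \<phi> x) x0"
    then have min: "\<forall>\<^sub>F x in nhds x0. u x0 - \<phi> x0 \<le> u x - \<phi> x" by (simp add: local_min_at_def)
    have upper: "w \<bullet> v \<le> L * \<bar>d \<bullet> v\<bar>" for v
    proof (rule tendsto_upperbound[OF quot])
      show "\<forall>\<^sub>F s in at_right 0. (\<phi> (x0 + s *\<^sub>R v) - \<phi> x0) / s - c \<bullet> v \<le> L * \<bar>d \<bullet> v\<bar>"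
        using eventually_compose_filterlim[OF min line[of v]] unfolding eventually_at_filter
      proof eventually_elim
        case (elim s)
        show ?case
        proof (intro impI)
          assume "s \<noteq> 0" "s \<in> {0<..}"
          then have "0 < s" by simp
          have "\<phi> (x0 + s *\<^sub>R v) - \<phi> x0 \<le> s * (c \<bullet> v) + L * \<bar>d \<bullet> v\<bar> * s"
            using elim f_line[of s v] \<open>0 < s\<close> by (simp add: u inner_add_right)
          with \<open>0 < s\<close> show "(\<phi> (x0 + s *\<^sub>R v) - \<phi> x0) / s - c \<bullet> v \<le> L * \<bar>d \<bullet> v\<bar>"
            by (simp add: field_simps)
        qed
      qed
    qed simp
    from upper[of v] upper[of "-v"] show ?thesis by simp
  qed
  note w_bound = this
  \<comment> \<open>For \<open>d = 0\<close> the quotient is 0, which is the right value because \<open>w = 0\<close> then.\<close>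
  define t where "t = (w \<bullet> d) / (d \<bullet> d)"
  have "d \<bullet> (w - t *\<^sub>R d) = 0"
    by (cases "d = 0") (simp_all add: t_def inner_diff_right inner_commute)
  with w_bound[of "w - t *\<^sub>R d"] have "(w - t *\<^sub>R d) \<bullet> (w - t *\<^sub>R d) = 0"
    by (simp add: inner_diff_left)
  then have w: "w = t *\<^sub>R d" by simp
  have "\<bar>t\<bar> \<le> L"
  proof (cases "d = 0")
    case True
    then show ?thesis using \<open>0 \<le> L\<close> by (simp add: t_def)
  next
    case False
    then have "0 < d \<bullet> d" by simp
    with w_bound[of d] show ?thesis by (simp add: w abs_mult)
  qed
  moreover have "gradient \<phi> x0 = c + t *\<^sub>R d" using w by (simp add: w_def algebra_simps)
  ultimately show ?thesis by (rule that)
qed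

text \<open>
  The strict bound on \<open>t\<close> leaves room to move from \<open>p\<close> in both directions \<open>\<plusminus>d\<close> inside the segment, so
  the two-sided derivative of \<open>H\<close> along \<open>d = (b - a) / 2\<close> is that of a constant.
\<close>
lemma gradient_orthogonal_to_constancy_segment:
  fixes H :: "'a::euclidean_space \<Rightarrow> real"
  assumes const: "H constant_on closed_segment a b"
    and diff: "H differentiable at p"
    and p: "p = (b + a) /\<^sub>R 2 + t *\<^sub>R ((b - a) /\<^sub>R 2)" and "\<bar>t\<bar> < 1"
  shows "gradient H p \<bullet> ((b - a) /\<^sub>R 2) = 0"
proof -
  let ?d = "(b - a) /\<^sub>R 2"
  obtain k where k: "\<And>y. y \<in> closed_segment a b \<Longrightarrow> H y = k"
    using const by (auto simp: constant_on_def)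
  have on_line: "H (p + s *\<^sub>R ?d) = k" if "\<bar>s\<bar> < 1 - \<bar>t\<bar>" for s
  proof (rule k)
    have "p + s *\<^sub>R ?d = (1 - (1 + t + s) / 2) *\<^sub>R a + ((1 + t + s) / 2) *\<^sub>R b"
      by (rule euclidean_eqI) (simp add: p inner_add_left inner_diff_left field_simps)
    then show "p + s *\<^sub>R ?d \<in> closed_segment a b"
      using that unfolding in_segment by (intro exI[of _ "(1 + t + s) / 2"]) auto
  qed
  have "((\<lambda>s. H (p + s *\<^sub>R ?d)) has_real_derivative gradient H p \<bullet> ?d) (at 0)"
    using has_real_derivative_gradient_line[of H p 0 ?d] diff by simp
  moreover have "((\<lambda>s. H (p + s *\<^sub>R ?d)) has_real_derivative 0) (at 0)"
    by (rule has_field_derivative_transform_within[OF DERIV_const, of "1 - \<bar>t\<bar>"])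
      (use \<open>\<bar>t\<bar> < 1\<close> on_line in \<open>auto simp: dist_real_def\<close>)
  ultimately show ?thesis by (rule DERIV_unique)
qed

lemma second_derivative_along_line:
  fixes \<phi> :: "'a::euclidean_space \<Rightarrow> real"
  assumes "open S" "x0 \<in> S" and C2: "Ck_on 2 S \<phi>"
  shows "\<forall>\<^sub>F s in nhds 0. ((\<lambda>s. \<phi> (x0 + s *\<^sub>R q)) has_real_derivative
      gradient \<phi> (x0 + s *\<^sub>R q) \<bullet> q) (at s)"
    and "((\<lambda>s. gradient \<phi> (x0 + s *\<^sub>R q) \<bullet> q) has_real_derivative
      (\<Sum>i\<in>Basis. \<Sum>j\<in>Basis. partial_deriv i (partial_deriv j \<phi>) x0 * (q \<bullet> i) * (q \<bullet> j))) (at 0)"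
proof -
  have diff: "\<And>x. x \<in> S \<Longrightarrow> \<phi> differentiable at x"
    and diff2: "\<And>x j. x \<in> S \<Longrightarrow> j \<in> Basis \<Longrightarrow> partial_deriv j \<phi> differentiable at x"
    using C2 by (auto simp: numeral_2_eq_2)
  have "((\<lambda>s::real. x0 + s *\<^sub>R q) \<longlongrightarrow> x0) (nhds 0)" by (auto intro!: tendsto_eq_intros filterlim_ident)
  then have "\<forall>\<^sub>F s in nhds 0. x0 + s *\<^sub>R q \<in> S"
    using \<open>open S\<close> \<open>x0 \<in> S\<close> by (rule topological_tendstoD)
  then show "\<forall>\<^sub>F s in nhds 0. ((\<lambda>s. \<phi> (x0 + s *\<^sub>R q)) has_real_derivative
      gradient \<phi> (x0 + s *\<^sub>R q) \<bullet> q) (at s)"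
    by eventually_elim (intro has_real_derivative_gradient_line diff)
  have "((\<lambda>s. partial_deriv j \<phi> (x0 + s *\<^sub>R q)) has_real_derivative
      gradient (partial_deriv j \<phi>) x0 \<bullet> q) (at 0)" if "j \<in> Basis" for j
    using has_real_derivative_gradient_line[of "partial_deriv j \<phi>" x0 0 q] diff2 that \<open>x0 \<in> S\<close> by simp
  then have "((\<lambda>s. \<Sum>j\<in>Basis. partial_deriv j \<phi> (x0 + s *\<^sub>R q) * (q \<bullet> j)) has_real_derivative
      (\<Sum>j\<in>Basis. (gradient (partial_deriv j \<phi>) x0 \<bullet> q) * (q \<bullet> j))) (at 0)"
    by (intro DERIV_sum DERIV_cmult_right)
  moreover have "gradient \<phi> y \<bullet> q = (\<Sum>j\<in>Basis. partial_deriv j \<phi> y * (q \<bullet> j))"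
    for y and \<phi> :: "'a \<Rightarrow> real"
    by (simp add: gradient_def inner_sum_left) (simp add: inner_commute)
  ultimately show "((\<lambda>s. gradient \<phi> (x0 + s *\<^sub>R q) \<bullet> q) has_real_derivative
      (\<Sum>i\<in>Basis. \<Sum>j\<in>Basis. partial_deriv i (partial_deriv j \<phi>) x0 * (q \<bullet> i) * (q \<bullet> j))) (at 0)"
    by (subst sum.swap) (simp add: sum_distrib_right)
qed

text \<open>
  With \<open>q\<close> the gradient of \<open>H\<close> at the gradient of \<open>\<phi>\<close>, the Aronsson operator is the second derivative
  of \<open>\<phi>\<close> along \<open>q\<close>. Since \<open>q\<close> is orthogonal to \<open>b - a\<close>, the argument of \<open>f\<close> does not change on the line
  through \<open>x0\<close> in direction \<open>q\<close>, and touching there means that \<open>m\<close> below has a local minimum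
  (touching from above) or maximum (touching from below).
\<close>
lemma aronsson_viscosity_solution_constancy_segment:
  fixes H :: "'a::euclidean_space \<Rightarrow> real"
  assumes u: "\<And>x. u x = ((b + a) /\<^sub>R 2) \<bullet> x + f (((b - a) /\<^sub>R 2) \<bullet> x)"
    and lip: "\<And>s t. \<bar>f s - f t\<bar> \<le> L * \<bar>s - t\<bar>" and "0 \<le> L" "L < 1"
    and H_diff: "\<And>p. H differentiable at p"
    and const: "H constant_on closed_segment a b"
  shows "aronsson_viscosity_solution H u"
  unfolding aronsson_viscosity_solution_def
proof (intro conjI allI impI)
  let ?d = "(b - a) /\<^sub>R 2"
  have "L-lipschitz_on UNIV f"
    using lip \<open>0 \<le> L\<close> by (intro lipschitz_onI) (auto simp: dist_real_def)
  then have "continuous_on UNIV f" by (rule lipschitz_on_continuous_on)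
  then have "continuous_on UNIV (\<lambda>x. ((b + a) /\<^sub>R 2) \<bullet> x + f (((b - a) /\<^sub>R 2) \<bullet> x))"
    by (intro continuous_on_add continuous_on_compose2[of UNIV f "UNIV" "\<lambda>x. ?d \<bullet> x"]
          continuous_on_inner continuous_on_const continuous_on_id subset_UNIV)
  then show "continuous_on UNIV u" by (simp add: u[abs_def])
next
  fix x0 :: 'a and \<phi>
  assume "C2_near x0 \<phi>"
  then obtain S where S: "open S" "x0 \<in> S" "Ck_on 2 S \<phi>" by (auto simp: C2_near_def)
  then have diff: "\<phi> differentiable at x0" by (simp add: numeral_2_eq_2)
  let ?c = "(b + a) /\<^sub>R 2 :: 'a" and ?d = "(b - a) /\<^sub>R 2 :: 'a"
  define q where "q = gradient H (gradient \<phi> x0)"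
  define m where "m = (\<lambda>s. \<phi> (x0 + s *\<^sub>R q) - s * (?c \<bullet> q))"
  define m' where "m' = (\<lambda>s. gradient \<phi> (x0 + s *\<^sub>R q) \<bullet> q - ?c \<bullet> q)"
  have q_basis: "q \<bullet> i = partial_deriv i H (gradient \<phi> x0)" if "i \<in> Basis" for i
    using that by (simp add: q_def gradient_def inner_sum_left_Basis)
  have m': "\<forall>\<^sub>F s in nhds 0. (m has_real_derivative m' s) (at s)"
    using second_derivative_along_line(1)[OF S, of q]
    by eventually_elim (auto simp: m_def m'_def intro!: derivative_eq_intros)
  have "(m' has_real_derivative
      (\<Sum>i\<in>Basis. \<Sum>j\<in>Basis. partial_deriv i (partial_deriv j \<phi>) x0 * (q \<bullet> i) * (q \<bullet> j)) - 0) (at 0)"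
    unfolding m'_def by (intro DERIV_diff DERIV_const second_derivative_along_line(2)[OF S])
  also have "(\<Sum>i\<in>Basis. \<Sum>j\<in>Basis. partial_deriv i (partial_deriv j \<phi>) x0 * (q \<bullet> i) * (q \<bullet> j)) - 0
      = aronsson H \<phi> x0"
    by (simp add: aronsson_def q_basis)
  finally have m'': "(m' has_real_derivative aronsson H \<phi> x0) (at 0)" .
  have u_line: "u (x0 + s *\<^sub>R q) = u x0 + s * (?c \<bullet> q)"
    if touch: "local_max_at (\<lambda>x. u x - \<phi> x) x0 \<or> local_min_at (\<lambda>x. u x - \<phi> x) x0" for s
  proof -
    obtain t where "\<bar>t\<bar> \<le> L" "gradient \<phi> x0 = ?c + t *\<^sub>R ?d"
      by (rule gradient_at_touching_point[OF u lip \<open>0 \<le> L\<close> diff touch])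
    then have "q \<bullet> ?d = 0"
      unfolding q_def using \<open>L < 1\<close>
      by (intro gradient_orthogonal_to_constancy_segment[OF const H_diff]) auto
    then have "?d \<bullet> (x0 + s *\<^sub>R q) = ?d \<bullet> x0"
      by (simp add: inner_add_right inner_commute)
    then show ?thesis
      unfolding u by (auto simp: inner_add_right)
  qed
  have line: "((\<lambda>s::real. x0 + s *\<^sub>R q) \<longlongrightarrow> x0) (nhds 0)" by (auto intro!: tendsto_eq_intros filterlim_ident)
  { assume max: "local_max_at (\<lambda>x. u x - \<phi> x) x0"
    have "\<forall>\<^sub>F s in nhds 0. m 0 \<le> m s"
      using eventually_compose_filterlim[OF max[unfolded local_max_at_def] line]
      by eventually_elim (use max in \<open>simp add: u_line m_def\<close>)
    then show "0 \<le> aronsson H \<phi> x0"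
      by (rule second_derivative_nonneg_at_local_min[OF _ m' m'']) }
  { assume min: "local_min_at (\<lambda>x. u x - \<phi> x) x0"
    have "\<forall>\<^sub>F s in nhds 0. - m 0 \<le> - m s"
      using eventually_compose_filterlim[OF min[unfolded local_min_at_def] line]
      by eventually_elim (use min in \<open>simp add: u_line m_def\<close>)
    moreover have "\<forall>\<^sub>F s in nhds 0. ((\<lambda>s. - m s) has_real_derivative - m' s) (at s)"
      using m' by eventually_elim (rule DERIV_minus)
    ultimately have "0 \<le> - aronsson H \<phi> x0"
      using DERIV_minus[OF m''] by (rule second_derivative_nonneg_at_local_min)
    then show "aronsson H \<phi> x0 \<le> 0" by simp }
qed

section \<open>The Aronsson equation\<close>

theorem theorem1:
  fixes H :: "real ^ 'n \<Rightarrow> real" and a b :: "real ^ 'n"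
    and f f' :: "real \<Rightarrow> real" and u :: "real ^ 'n \<Rightarrow> real"
  assumes "CARD('n) \<ge> 2"
    and "Ck_on 1 UNIV H"
    and "H constant_on closed_segment a b"
    and "W1inf_loc f" and "continuous_on UNIV f"
    and "has_weak_partial f 1 f'" and "Linf_norm f' < 1"
    and "\<And>x. u x = ((b + a) /\<^sub>R 2) \<bullet> x + f (((b - a) /\<^sub>R 2) \<bullet> x)"
  shows "W1inf_loc u \<and> aronsson_viscosity_solution H u"
proof -
  obtain g L where g: "g \<in> borel_measurable borel" "\<And>x. \<bar>g x\<bar> \<le> L" and "L < 1"
    and ftc: "\<And>s t. s < t \<Longrightarrow> f t - f s = (LINT x|lborel. indicator {s..t} x * g x)"
    using bounded_borel_derivative[OF assms(5-7)] by blast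
  have "0 \<le> L" using g(2)[of 0] by linarith
  have lip: "\<bar>f s - f t\<bar> \<le> L * \<bar>s - t\<bar>" for s t
    by (rule lipschitz_of_bounded_derivative[OF g ftc])
  have u: "u = (\<lambda>x. ((b + a) /\<^sub>R 2) \<bullet> x + f (((b - a) /\<^sub>R 2) \<bullet> x))"
    using assms(8) by (rule ext)
  have "W1inf_loc u"
    unfolding u by (rule W1inf_loc_plane_wave[OF assms(5) g ftc])
  moreover have "H differentiable at p" for p
    using assms(2) by simp
  then have "aronsson_viscosity_solution H u"
    by (rule aronsson_viscosity_solution_constancy_segment[OF assms(8) lip \<open>0 \<le> L\<close> \<open>L < 1\<close> _ assms(3)])
  ultimately show ?thesis by blast
qed

end
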